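(* Let $\mathbf{M}$ be a compact smooth $m$-dimensional submanifold without boundary of $\mathbf{R}^s$, with cutlocus $\mathbf{C}$ and nearest-point mapping $\pi:\mathbf{R}^s\setminus\mathbf{C}\to\mathbf{M}$. Let $(t_n)$ be a sequence in $\mathbf{R}^s$, let $(\tilde t_n)$ be random vectors in $\mathbf{R}^s$, and let $B_n$ be nonsingular $s\times s$ matrices with $B_n\to 0$ such that $$Z_n=B_n^{-1}(\tilde t_n-t_n)\xrightarrow{\mathcal D} Z\quad (n\to\infty)$$ for some random vector $Z$ in $\mathbf{R}^s$. Put $\mu_n=\pi(t_n)$ and $\tilde\mu_n=\pi(\tilde t_n)$. Suppose $t_n\notin\mathbf{C}$ and $d(t_n,\mathbf{M})\le D$ for all $n$, for some constant $D>0$. If $\|B_n\|/d(t_n,\mathbf{C})\to 0$, then $\|\tilde\mu_n-\mu_n\|\to 0$ in probability.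
   Context: $\|\cdot\|$ is the Euclidean norm on $\mathbf{R}^s$ and the operator norm on matrices; for a closed set $A\subset\mathbf{R}^s$, $d(t,A)=\inf_{a\in A}\|t-a\|$. For $x\in\mathbf{R}^s$ let $L_x(\mu)=\|\mu-x\|^2$, $\mu\in\mathbf{M}$. The cutlocus $\mathbf{C}$ is the (closed) set of $x\in\mathbf{R}^s$ such that either the minimizer of $L_x$ over $\mathbf{M}$ is not unique, or $L_x$ has a degenerate second derivative (Hessian) at its minimizer. For $x\notin\mathbf{C}$, $\pi(x)=\arg\min_{\mu\in\mathbf{M}}\|\mu-x\|$. Convergence in distribution is denoted $\xrightarrow{\mathcal D}$. *)

theory Defs
  imports "HOL-Analysis.Analysis" "HOL-Probability.Probability"
begin

fun Ck_on :: "nat \<Rightarrow> ('a::real_normed_vector) set \<Rightarrow> ('a \<Rightarrow> 'b::real_normed_vector) \<Rightarrow> bool" where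
  "Ck_on 0 S f = continuous_on S f"
| "Ck_on (Suc k) S f =
     (\<exists>f'. (\<forall>x\<in>S. (f has_derivative f' x) (at x within S)) \<and> (\<forall>v. Ck_on k S (\<lambda>x. f' x v)))"

definition smooth_on :: "('a::real_normed_vector) set \<Rightarrow> ('a \<Rightarrow> 'b::real_normed_vector) \<Rightarrow> bool" where
  "smooth_on S f \<longleftrightarrow> (\<forall>k. Ck_on k S f)"

text \<open>The parameter domain is a relatively open subset W of an m-dimensional linear
  subspace L of R^s (identified with R^m); psi is a smooth immersion which is a homeomorphism
  of W onto the relatively open piece M \<inter> U of M.\<close>

definition is_chart :: "nat \<Rightarrow> (real^'n) set \<Rightarrow> (real^'n) set \<Rightarrow> (real^'n) set
     \<Rightarrow> (real^'n \<Rightarrow> real^'n) \<Rightarrow> (real^'n) set \<Rightarrow> bool" where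
  "is_chart m M L W \<psi> U \<longleftrightarrow>
     subspace L \<and> dim L = m \<and> openin (top_of_set L) W \<and> open U \<and>
     smooth_on W \<psi> \<and> (\<exists>\<phi>. homeomorphism W (M \<inter> U) \<psi> \<phi>) \<and>
     (\<forall>w\<in>W. \<exists>D. (\<psi> has_derivative D) (at w within W) \<and> inj_on D L)"

definition smooth_compact_submanifold :: "nat \<Rightarrow> (real^'n) set \<Rightarrow> bool" where
  "smooth_compact_submanifold m M \<longleftrightarrow> compact M \<and>
     (\<forall>p\<in>M. \<exists>L W \<psi> U. is_chart m M L W \<psi> U \<and> p \<in> U)"

definition hessian_degenerate ::
  "(real^'n) set \<Rightarrow> (real^'n) set \<Rightarrow> (real^'n \<Rightarrow> real) \<Rightarrow> real^'n \<Rightarrow> bool" where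
  "hessian_degenerate L W g w0 \<longleftrightarrow>
     (\<exists>g' g''. (\<forall>w\<in>W. (g has_derivative g' w) (at w within W)) \<and>
        (\<forall>v\<in>L. ((\<lambda>w. g' w v) has_derivative g'' v) (at w0 within W)) \<and>
        (\<exists>u\<in>L. u \<noteq> 0 \<and> (\<forall>v\<in>L. g'' v u = 0)))"

definition is_nearest :: "(real^'n) set \<Rightarrow> real^'n \<Rightarrow> real^'n \<Rightarrow> bool" where
  "is_nearest M x \<mu> \<longleftrightarrow> \<mu> \<in> M \<and> (\<forall>\<nu>\<in>M. norm (\<mu> - x) \<le> norm (\<nu> - x))"

definition cutlocus :: "nat \<Rightarrow> (real^'n) set \<Rightarrow> (real^'n) set" where
  "cutlocus m M = {x. \<not> (\<exists>!\<mu>. is_nearest M x \<mu>) \<or>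
     (\<exists>\<mu>. is_nearest M x \<mu> \<and>
        (\<exists>L W \<psi> U w0. is_chart m M L W \<psi> U \<and> w0 \<in> W \<and> \<psi> w0 = \<mu> \<and>
           hessian_degenerate L W (\<lambda>w. (norm (\<psi> w - x))\<^sup>2) w0))}"

definition nearest_point :: "(real^'n) set \<Rightarrow> real^'n \<Rightarrow> real^'n" where
  "nearest_point M x = (THE \<mu>. is_nearest M x \<mu>)"

definition conv_in_distribution ::
  "'a measure \<Rightarrow> (nat \<Rightarrow> 'a \<Rightarrow> 'c::euclidean_space) \<Rightarrow> 'b measure \<Rightarrow> ('b \<Rightarrow> 'c) \<Rightarrow> bool" where
  "conv_in_distribution P X Q Y \<longleftrightarrow>
     (\<forall>f :: 'c \<Rightarrow> real. continuous_on UNIV f \<and> bounded (range f) \<longrightarrow>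
        (\<lambda>n. \<integral>\<omega>. f (X n \<omega>) \<partial>P) \<longlonglongrightarrow> (\<integral>\<omega>. f (Y \<omega>) \<partial>Q))"

end

theory Submission
  imports Defs
begin

text \<open>
  A point x lies outside the cutlocus iff it has a nearest point \<open>\<nu>\<close> for which the squared distance
  grows quadratically on M: \<open>|\<nu>' - x|\<^sup>2 \<ge> |\<nu> - x|\<^sup>2 + c |\<nu>' - \<nu>|\<^sup>2\<close> for some \<open>c > 0\<close>. This condition
  does not mention charts, and it is open in x, so the cutlocus is closed. It also shows
  that the foot point \<open>\<mu> = \<pi>(x)\<close> of x stays nearest along the ray from \<open>\<mu>\<close> through x until the ray
  meets the cutlocus. Comparing \<open>\<mu>\<close> and \<open>\<pi>(y)\<close> from a point further out on that ray gives, with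
  \<open>e = d(x, C)\<close>, the bound \<open>|\<pi>(y) - \<pi>(x)| \<le> 2 |y - x| (1 + 2D/e)\<close> for \<open>|y - x| < e\<close>. Tightness of
  \<open>Z\<^sub>n\<close> turns this into the claim.
\<close>

text \<open>A derivative within a relatively open subset of a subspace \<open>L\<close> is
  determined only in the directions of \<open>L\<close>, so the calculus below runs mostly along
  lines inside the parameter domain. Passing from a nondegenerate Hessian to quadratic growth needs
  three things. Second derivatives must be symmetric: at a minimizer the Hessian is positive
  semidefinite, and it is symmetry that forces a vector \<open>u\<close> with
  \<open>H u u = 0\<close> into the kernel. Positivity must be uniform near the base point, because
  the nearest point moves with y. Finally, points of M far from the foot point are handled by
  compactness. The factor \<open>1 + 2D/e\<close> is \<open>\<Lambda>/(\<Lambda> - 1)\<close>, where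
  \<open>\<Lambda>\<close> says how far the ray can be stretched beyond x without meeting the
  cutlocus.\<close>

section \<open>Symmetry of mixed second derivatives\<close>

lemma mean_value_twice:
  fixes G Gs Gst :: "real \<Rightarrow> real \<Rightarrow> real"
  assumes "0 < h" "h < r"
    and Gs: "\<And>s t. \<bar>s\<bar> < r \<Longrightarrow> \<bar>t\<bar> < r \<Longrightarrow> ((\<lambda>s. G s t) has_real_derivative Gs s t) (at s)"
    and Gst: "\<And>s t. \<bar>s\<bar> < r \<Longrightarrow> \<bar>t\<bar> < r \<Longrightarrow> ((\<lambda>t. Gs s t) has_real_derivative Gst s t) (at t)"
  obtains \<xi> \<eta> where "0 < \<xi>" "\<xi> < h" "0 < \<eta>" "\<eta> < h"
    "G h h - G h 0 - G 0 h + G 0 0 = h * h * Gst \<xi> \<eta>"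
proof -
  \<comment> \<open>The mean value theorem is applied to \<open>s \<mapsto> G s h - G s 0\<close>
    and then to \<open>Gs \<xi>\<close>. The second difference is symmetric in the two variables, so
    the lemma can be used in both orders.\<close>
  have "\<exists>\<xi>. 0 < \<xi> \<and> \<xi> < h \<and> (G h h - G h 0) - (G 0 h - G 0 0) = (h - 0) * (Gs \<xi> h - Gs \<xi> 0)"
    using assms(1,2) by (intro MVT2 derivative_intros Gs) auto
  then obtain \<xi> where \<xi>: "0 < \<xi>" "\<xi> < h"
    "(G h h - G h 0) - (G 0 h - G 0 0) = h * (Gs \<xi> h - Gs \<xi> 0)"
    by auto
  have "\<exists>\<eta>. 0 < \<eta> \<and> \<eta> < h \<and> Gs \<xi> h - Gs \<xi> 0 = (h - 0) * Gst \<xi> \<eta>"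
    using assms(1,2) \<xi> by (intro MVT2 Gst) auto
  then show ?thesis using \<xi> that by (auto simp: algebra_simps)
qed

text \<open>Schwarz's theorem: both mixed derivatives represent the same second difference divided
  by \<open>h * h\<close>, at points that shrink to the origin with \<open>h\<close>.\<close>

lemma mixed_derivatives_eq:
  fixes G Gs Gt Gst Gts :: "real \<Rightarrow> real \<Rightarrow> real"
  assumes "0 < r"
    and Gs: "\<And>s t. \<bar>s\<bar> < r \<Longrightarrow> \<bar>t\<bar> < r \<Longrightarrow> ((\<lambda>s. G s t) has_real_derivative Gs s t) (at s)"
    and Gt: "\<And>s t. \<bar>s\<bar> < r \<Longrightarrow> \<bar>t\<bar> < r \<Longrightarrow> ((\<lambda>t. G s t) has_real_derivative Gt s t) (at t)"
    and Gst: "\<And>s t. \<bar>s\<bar> < r \<Longrightarrow> \<bar>t\<bar> < r \<Longrightarrow> ((\<lambda>t. Gs s t) has_real_derivative Gst s t) (at t)"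
    and Gts: "\<And>s t. \<bar>s\<bar> < r \<Longrightarrow> \<bar>t\<bar> < r \<Longrightarrow> ((\<lambda>s. Gt s t) has_real_derivative Gts s t) (at s)"
    and cst: "isCont (\<lambda>p. Gst (fst p) (snd p)) (0,0)"
    and cts: "isCont (\<lambda>p. Gts (fst p) (snd p)) (0,0)"
  shows "Gst 0 0 = Gts 0 0"
proof (rule ccontr)
  assume "Gst 0 0 \<noteq> Gts 0 0"
  define e where "e = dist (Gst 0 0) (Gts 0 0) / 2"
  have "e > 0" using \<open>Gst 0 0 \<noteq> Gts 0 0\<close> by (simp add: e_def)
  obtain d1 where "d1 > 0" and
    d1: "\<And>p. dist p (0,0) < d1 \<Longrightarrow> dist (Gst (fst p) (snd p)) (Gst 0 0) < e"
    using cst[unfolded continuous_at_eps_delta, rule_format, OF \<open>e > 0\<close>] by auto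
  obtain d2 where "d2 > 0" and
    d2: "\<And>p. dist p (0,0) < d2 \<Longrightarrow> dist (Gts (fst p) (snd p)) (Gts 0 0) < e"
    using cts[unfolded continuous_at_eps_delta, rule_format, OF \<open>e > 0\<close>] by auto
  define h where "h = min r (min d1 d2) / 2"
  have h: "0 < h" "h < r" "2 * h \<le> d1" "2 * h \<le> d2"
    using assms(1) \<open>d1 > 0\<close> \<open>d2 > 0\<close> by (auto simp: h_def)
  have small: "dist (s,t) (0,0) < 2 * h" if "0 < s" "s < h" "0 < t" "t < h" for s t :: real
  proof -
    have "norm (s,t) \<le> norm s + norm t" by (simp add: norm_Pair sqrt_sum_squares_le_sum_abs)
    then have "norm (s,t) < 2 * h" using that by simp
    then show ?thesis by (simp add: dist_norm)
  qed
  obtain \<xi> \<eta> where 1: "0 < \<xi>" "\<xi> < h" "0 < \<eta>" "\<eta> < h"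
    "G h h - G h 0 - G 0 h + G 0 0 = h * h * Gst \<xi> \<eta>"
    using mean_value_twice[OF h(1,2) Gs Gst] by blast
  obtain \<eta>' \<xi>' where 2: "0 < \<xi>'" "\<xi>' < h" "0 < \<eta>'" "\<eta>' < h"
    "G h h - G 0 h - G h 0 + G 0 0 = h * h * Gts \<xi>' \<eta>'"
    using mean_value_twice[where G="\<lambda>s t. G t s" and Gs = "\<lambda>s t. Gt t s"
        and Gst = "\<lambda>s t. Gts t s", OF h(1,2) Gt Gts] by blast
  have "h * h * Gst \<xi> \<eta> = h * h * Gts \<xi>' \<eta>'" using 1(5) 2(5) by linarith
  then have eq: "Gst \<xi> \<eta> = Gts \<xi>' \<eta>'" using h by simp
  have "dist (Gst \<xi> \<eta>) (Gst 0 0) < e" "dist (Gts \<xi>' \<eta>') (Gts 0 0) < e"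
    using d1[of "(\<xi>,\<eta>)"] d2[of "(\<xi>',\<eta>')"] small[OF 1(1-4)] small[OF 2(1-4)] h by auto
  with eq show False
    using dist_triangle2[of "Gst 0 0" "Gts 0 0" "Gts \<xi>' \<eta>'"] by (simp add: e_def dist_commute)
qed

text \<open>As \<open>W\<close> is relatively open in \<open>L\<close>, the \<open>t\<close> with
  \<open>w + t *\<^sub>R v \<in> W\<close> form an open set of reals, so a derivative within
  \<open>W\<close> becomes an ordinary two-sided one.\<close>

lemma has_vector_derivative_along_line:
  fixes F :: "'a::real_normed_vector \<Rightarrow> 'b::real_normed_vector"
  assumes "subspace L" "openin (top_of_set L) W" "w \<in> L" "v \<in> L" "w + s *\<^sub>R v \<in> W"
    and F: "(F has_derivative F') (at (w + s *\<^sub>R v) within W)"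
  shows "((\<lambda>t. F (w + t *\<^sub>R v)) has_vector_derivative F' v) (at s)"
proof -
  obtain O' where O': "open O'" "W = L \<inter> O'" using assms(2) openin_open by blast
  define T where "T = (\<lambda>t. w + t *\<^sub>R v) -` O'"
  have "open T" unfolding T_def using O'(1) by (intro open_vimage continuous_intros)
  have sub: "(\<lambda>t. w + t *\<^sub>R v) ` T \<subseteq> W"
    using assms(1,3,4) O' by (auto simp: T_def subspace_add subspace_scale)
  have "s \<in> T" using assms(5) O' by (auto simp: T_def)
  have 1: "((\<lambda>t. w + t *\<^sub>R v) has_derivative (\<lambda>t. t *\<^sub>R v)) (at s within T)"
    by (auto intro!: derivative_eq_intros)
  have "(F has_derivative F') (at (w + s *\<^sub>R v) within (\<lambda>t. w + t *\<^sub>R v) ` T)"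
    using F sub by (rule has_derivative_subset)
  from diff_chain_within[OF 1 this]
  have "((\<lambda>t. F (w + t *\<^sub>R v)) has_derivative (\<lambda>t. F' (t *\<^sub>R v))) (at s within T)"
    by (simp add: o_def)
  moreover have "F' (t *\<^sub>R v) = t *\<^sub>R F' v" for t
    by (rule linear_cmul[OF has_derivative_linear[OF F]])
  ultimately show ?thesis
    by (simp only: has_vector_derivative_def at_within_open[OF \<open>s \<in> T\<close> \<open>open T\<close>])
qed

section \<open>The squared distance to a fixed point in a parametrization\<close>

text \<open>\<open>f2 v w u\<close> is the derivative at \<open>w\<close> in direction
  \<open>u\<close> of the first derivative in direction \<open>v\<close>. In the application
  \<open>E\<close> is an orthonormal basis of \<open>L\<close>; vectors of \<open>L\<close> are
  expanded in it, which reduces everything to finitely many fixed directions.\<close>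

locale C2_patch =
  fixes L W E :: "'a::euclidean_space set" and F :: "'a \<Rightarrow> 'b::euclidean_space"
    and f1 :: "'a \<Rightarrow> 'a \<Rightarrow> 'b" and f2 :: "'a \<Rightarrow> 'a \<Rightarrow> 'a \<Rightarrow> 'b"
  assumes L: "subspace L" and W: "openin (top_of_set L) W"
    and E: "finite E" "E \<subseteq> L" "\<And>v. v \<in> L \<Longrightarrow> (\<Sum>e\<in>E. (v \<bullet> e) *\<^sub>R e) = v"
    and f1: "\<And>w. w \<in> W \<Longrightarrow> (F has_derivative f1 w) (at w within W)"
    and f2: "\<And>v w. w \<in> W \<Longrightarrow> ((\<lambda>w. f1 w v) has_derivative f2 v w) (at w within W)"
    and f2_cont: "\<And>u v. continuous_on W (\<lambda>w. f2 v w u)"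
begin

lemma W_subset: "W \<subseteq> L"
  using W openin_imp_subset by blast

lemma F_cont: "continuous_on W F"
  using f1 has_derivative_continuous_on by blast

lemma f1_cont: "continuous_on W (\<lambda>w. f1 w v)"
  using f2 has_derivative_continuous_on by blast

text \<open>For \<open>v\<close>, \<open>u\<close> in L, \<open>T w v\<close> is the derivative of F at w and \<open>H y w v u\<close> is half the Hessian of
  \<open>|F - y|\<^sup>2\<close> at w. Written in the orthonormal basis E of L they are jointly continuous,
  although the derivatives themselves are only known to be continuous for fixed directions.\<close>

definition T :: "'a \<Rightarrow> 'a \<Rightarrow> 'b" where
  "T w v = (\<Sum>b\<in>E. (v \<bullet> b) *\<^sub>R f1 w b)"

definition H :: "'b \<Rightarrow> 'a \<Rightarrow> 'a \<Rightarrow> 'a \<Rightarrow> real" where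
  "H y w v u = (\<Sum>b\<in>E. \<Sum>a\<in>E. (v \<bullet> b) * (u \<bullet> a) * (f2 b w a \<bullet> (F w - y) + f1 w b \<bullet> f1 w a))"

lemma linear_expand:
  assumes "linear f" "v \<in> L"
  shows "f v = (\<Sum>b\<in>E. (v \<bullet> b) *\<^sub>R f b)"
proof -
  have "f v = f (\<Sum>b\<in>E. (v \<bullet> b) *\<^sub>R b)" by (simp only: E(3)[OF assms(2)])
  then show ?thesis by (simp add: linear_sum[OF assms(1)] linear_cmul[OF assms(1)])
qed

lemma linear_f1: "w \<in> W \<Longrightarrow> linear (f1 w)"
  using f1 has_derivative_linear by blast

lemma linear_f2: "w \<in> W \<Longrightarrow> linear (f2 v w)"
  using f2 has_derivative_linear by blast

lemma T_eq: "w \<in> W \<Longrightarrow> v \<in> L \<Longrightarrow> f1 w v = T w v"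
  unfolding T_def using linear_f1 linear_expand by blast

lemma H_eq:
  assumes "w \<in> W" "u \<in> L"
  shows "H y w v u = (\<Sum>b\<in>E. (v \<bullet> b) * (f2 b w u \<bullet> (F w - y) + f1 w b \<bullet> T w u))"
proof -
  have "f2 b w u \<bullet> (F w - y) + f1 w b \<bullet> T w u
      = (\<Sum>a\<in>E. (u \<bullet> a) * (f2 b w a \<bullet> (F w - y) + f1 w b \<bullet> f1 w a))" for b
    unfolding linear_expand[OF linear_f2[OF assms(1)] assms(2)] T_def
    by (simp add: inner_sum_left inner_sum_right sum.distrib distrib_left)
  then show ?thesis
    unfolding H_def by (simp add: sum_distrib_left mult.assoc)
qed

lemma line_deriv:
  assumes "w \<in> L" "v \<in> L" "w + s *\<^sub>R v \<in> W"
  shows "((\<lambda>t. F (w + t *\<^sub>R v)) has_vector_derivative T (w + s *\<^sub>R v) v) (at s)"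
  using has_vector_derivative_along_line[OF L W assms f1[OF assms(3)]] T_eq assms by simp

lemma line_deriv_T:
  assumes "w \<in> L" "v \<in> L" "w + s *\<^sub>R v \<in> W"
  shows "((\<lambda>t. T (w + t *\<^sub>R v) u) has_vector_derivative
     (\<Sum>b\<in>E. (u \<bullet> b) *\<^sub>R f2 b (w + s *\<^sub>R v) v)) (at s)"
  unfolding T_def
  by (intro derivative_intros has_vector_derivative_sum
      has_vector_derivative_along_line[OF L W assms f2[OF assms(3)]]
      bounded_linear.has_vector_derivative[OF bounded_linear_scaleR_right])

lemma sq_line_deriv:
  assumes "w \<in> L" "v \<in> L" "w + s *\<^sub>R v \<in> W"
  shows "((\<lambda>t. (norm (F (w + t *\<^sub>R v) - y))\<^sup>2) has_real_derivative
     2 * (T (w + s *\<^sub>R v) v \<bullet> (F (w + s *\<^sub>R v) - y))) (at s)"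
proof -
  note d = line_deriv[OF assms, unfolded has_vector_derivative_def]
  have "((\<lambda>t. (F (w + t *\<^sub>R v) - y) \<bullet> (F (w + t *\<^sub>R v) - y)) has_derivative
      (\<lambda>h. (F (w + s *\<^sub>R v) - y) \<bullet> (h *\<^sub>R T (w + s *\<^sub>R v) v - 0) +
        (h *\<^sub>R T (w + s *\<^sub>R v) v - 0) \<bullet> (F (w + s *\<^sub>R v) - y))) (at s)"
    by (intro has_derivative_inner d has_derivative_diff has_derivative_const)
  then show ?thesis
    unfolding power2_norm_eq_inner has_field_derivative_def
    by (elim has_derivative_eq_rhs) (simp add: fun_eq_iff inner_commute)
qed

lemma sq_line_deriv2:
  assumes "w \<in> L" "v \<in> L" "w + s *\<^sub>R v \<in> W"
  shows "((\<lambda>t. 2 * (T (w + t *\<^sub>R v) v \<bullet> (F (w + t *\<^sub>R v) - y))) has_real_derivative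
     2 * H y (w + s *\<^sub>R v) v v) (at s)"
proof -
  note d = line_deriv[OF assms, unfolded has_vector_derivative_def]
  note d2 = line_deriv_T[OF assms, of v, unfolded has_vector_derivative_def]
  have "H y (w + s *\<^sub>R v) v v = (\<Sum>b\<in>E. (v \<bullet> b) *\<^sub>R f2 b (w + s *\<^sub>R v) v) \<bullet> (F (w + s *\<^sub>R v) - y)
      + T (w + s *\<^sub>R v) v \<bullet> T (w + s *\<^sub>R v) v"
  proof -
    have "T z v \<bullet> k = (\<Sum>b\<in>E. (v \<bullet> b) * (f1 z b \<bullet> k))" for z k
      by (simp add: T_def inner_sum_left)
    then show ?thesis
      unfolding H_eq[OF assms(3,2)] by (simp add: inner_sum_left sum.distrib distrib_left)
  qed
  moreover have "((\<lambda>t. T (w + t *\<^sub>R v) v \<bullet> (F (w + t *\<^sub>R v) - y)) has_derivative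
      (\<lambda>h. T (w + s *\<^sub>R v) v \<bullet> (h *\<^sub>R T (w + s *\<^sub>R v) v - 0) +
        (h *\<^sub>R (\<Sum>b\<in>E. (v \<bullet> b) *\<^sub>R f2 b (w + s *\<^sub>R v) v)) \<bullet> (F (w + s *\<^sub>R v) - y))) (at s)"
    by (intro has_derivative_inner d2 has_derivative_diff d has_derivative_const)
  ultimately have "((\<lambda>t. T (w + t *\<^sub>R v) v \<bullet> (F (w + t *\<^sub>R v) - y)) has_real_derivative
      H y (w + s *\<^sub>R v) v v) (at s)"
    unfolding has_field_derivative_def
    by (elim has_derivative_eq_rhs) (simp add: fun_eq_iff distrib_left mult.commute)
  then show ?thesis by (rule DERIV_cmult)
qed

text \<open>The scalar Schwarz theorem is applied to each component of \<open>F\<close> on the plane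
  through \<open>w\<close> spanned by \<open>a\<close> and \<open>b\<close>.\<close>

lemma f2_sym:
  assumes "w \<in> W" "a \<in> L" "b \<in> L"
  shows "f2 b w a = f2 a w b"
proof (rule euclidean_eqI)
  fix k :: 'b assume "k \<in> Basis"
  obtain O' where O': "open O'" "W = L \<inter> O'" using W openin_open by blast
  define p where "p = (\<lambda>z::real\<times>real. w + fst z *\<^sub>R a + snd z *\<^sub>R b)"
  have p_cont: "continuous_on UNIV p" unfolding p_def by (intro continuous_intros)
  have pL: "p z \<in> L" for z
    using assms W_subset L by (auto simp: p_def intro!: subspace_add subspace_scale)
  \<comment> \<open>The open preimage contains a product neighbourhood of the origin, hence a square
    of half-width \<open>r\<close>, as the scalar lemma demands.\<close>
  have "open (p -` O')" using O'(1) p_cont by (simp add: open_vimage)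
  moreover have "(0,0) \<in> p -` O'" using assms O' by (simp add: p_def)
  ultimately obtain A B where AB: "open A" "open B" "(0,0) \<in> A \<times> B" "A \<times> B \<subseteq> p -` O'"
    by (rule open_prod_elim)
  obtain r1 where r1: "r1 > 0" "ball 0 r1 \<subseteq> A" using openE[of A 0] AB(1,3) by auto
  obtain r2 where r2: "r2 > 0" "ball 0 r2 \<subseteq> B" using openE[of B 0] AB(2,3) by auto
  define r where "r = min r1 r2"
  have "r > 0" using r1 r2 by (simp add: r_def)
  have inW: "w + s *\<^sub>R a + t *\<^sub>R b \<in> W" if "\<bar>s\<bar> < r" "\<bar>t\<bar> < r" for s t
  proof -
    have "s \<in> A" "t \<in> B" using that r1 r2 by (auto simp: r_def subset_iff dist_real_def)
    then have "p (s,t) \<in> O'" using AB(4) by blast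
    then show ?thesis using pL[of "(s,t)"] O' by (simp add: p_def)
  qed
  have line_a: "((\<lambda>s. K (w + s *\<^sub>R a + t *\<^sub>R b) \<bullet> k) has_real_derivative
      (K' (w + s *\<^sub>R a + t *\<^sub>R b) a \<bullet> k)) (at s)"
    if st: "\<bar>s\<bar> < r" "\<bar>t\<bar> < r" and
      K: "\<And>x. x \<in> W \<Longrightarrow> (K has_derivative K' x) (at x within W)"
    for s t and K :: "'a \<Rightarrow> 'b" and K'
  proof -
    have eq: "w + s *\<^sub>R a + t *\<^sub>R b = (w + t *\<^sub>R b) + s *\<^sub>R a" for s by simp
    have "w + t *\<^sub>R b \<in> L" using assms W_subset L by (auto intro!: subspace_add subspace_scale)
    then have "((\<lambda>s. K ((w + t *\<^sub>R b) + s *\<^sub>R a)) has_vector_derivative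
        K' ((w + t *\<^sub>R b) + s *\<^sub>R a) a) (at s)"
      using inW[OF st] K assms eq by (intro has_vector_derivative_along_line[OF L W]) auto
    from bounded_linear.has_vector_derivative[OF bounded_linear_inner_left this]
    show ?thesis by (simp add: eq has_real_derivative_iff_has_vector_derivative)
  qed
  have line_b: "((\<lambda>t. K (w + s *\<^sub>R a + t *\<^sub>R b) \<bullet> k) has_real_derivative
      (K' (w + s *\<^sub>R a + t *\<^sub>R b) b \<bullet> k)) (at t)"
    if st: "\<bar>s\<bar> < r" "\<bar>t\<bar> < r" and
      K: "\<And>x. x \<in> W \<Longrightarrow> (K has_derivative K' x) (at x within W)"
    for s t and K :: "'a \<Rightarrow> 'b" and K'
  proof -
    have "w + s *\<^sub>R a \<in> L" using assms W_subset L by (auto intro!: subspace_add subspace_scale)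
    then have "((\<lambda>t. K ((w + s *\<^sub>R a) + t *\<^sub>R b)) has_vector_derivative
        K' ((w + s *\<^sub>R a) + t *\<^sub>R b) b) (at t)"
      using inW[OF st] K assms by (intro has_vector_derivative_along_line[OF L W]) auto
    from bounded_linear.has_vector_derivative[OF bounded_linear_inner_left this]
    show ?thesis by (simp add: has_real_derivative_iff_has_vector_derivative)
  qed
  have cont: "isCont (\<lambda>z. f2 c (w + fst z *\<^sub>R a + snd z *\<^sub>R b) d \<bullet> k) (0,0)" for c d
  proof -
    have "continuous_on (A \<times> B) (\<lambda>z. f2 c (p z) d \<bullet> k)"
    proof (rule continuous_on_inner[OF continuous_on_compose2[OF f2_cont] continuous_on_const])
      show "continuous_on (A \<times> B) p" using p_cont continuous_on_subset by blast
      show "p ` (A \<times> B) \<subseteq> W" using AB(4) pL O' by auto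
    qed
    then show ?thesis
      using AB(1,2,3) unfolding p_def
      by (simp add: continuous_on_eq_continuous_at open_Times)
  qed
  have "(\<lambda>s t. f2 a (w + s *\<^sub>R a + t *\<^sub>R b) b \<bullet> k) 0 0 = (\<lambda>s t. f2 b (w + s *\<^sub>R a + t *\<^sub>R b) a \<bullet> k) 0 0"
  proof (rule mixed_derivatives_eq[where G = "\<lambda>s t. F (w + s *\<^sub>R a + t *\<^sub>R b) \<bullet> k"
          and Gs = "\<lambda>s t. f1 (w + s *\<^sub>R a + t *\<^sub>R b) a \<bullet> k"
          and Gt = "\<lambda>s t. f1 (w + s *\<^sub>R a + t *\<^sub>R b) b \<bullet> k"
          and Gst = "\<lambda>s t. f2 a (w + s *\<^sub>R a + t *\<^sub>R b) b \<bullet> k"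
          and Gts = "\<lambda>s t. f2 b (w + s *\<^sub>R a + t *\<^sub>R b) a \<bullet> k", OF \<open>r > 0\<close>], goal_cases)
    case (1 s t) then show ?case by (rule line_a[where K = F and K' = f1]) (rule f1)
  next
    case (2 s t) then show ?case by (rule line_b[where K = F and K' = f1]) (rule f1)
  next
    case (3 s t) then show ?case by (rule line_b[where K = "\<lambda>w. f1 w a" and K' = "f2 a"]) (rule f2)
  next
    case (4 s t) then show ?case by (rule line_a[where K = "\<lambda>w. f1 w b" and K' = "f2 b"]) (rule f2)
  qed (rule cont)+
  then show "f2 b w a \<bullet> k = f2 a w b \<bullet> k" by simp
qed

lemma H_sym:
  assumes "w \<in> W" shows "H y w v u = H y w u v"
proof -
  have "H y w v u = (\<Sum>a\<in>E. \<Sum>b\<in>E. (v \<bullet> b) * (u \<bullet> a) * (f2 b w a \<bullet> (F w - y) + f1 w b \<bullet> f1 w a))"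
    unfolding H_def by (rule sum.swap)
  also have "\<dots> = H y w u v"
    unfolding H_def using f2_sym[OF assms] E(2)
    by (intro sum.cong refl) (auto simp: inner_commute mult.commute subset_iff)
  finally show ?thesis .
qed

lemma H_add: "H y w (v + v') u = H y w v u + H y w v' u" "H y w v (u + u') = H y w v u + H y w v u'"
  unfolding H_def by (simp_all only: inner_add_left distrib_left distrib_right sum.distrib)

lemma H_scale: "H y w (c *\<^sub>R v) u = c * H y w v u" "H y w v (c *\<^sub>R u) = c * H y w v u"
  unfolding H_def by (simp_all add: sum_distrib_left mult_ac)

lemma H_cont:
  "continuous_on (UNIV \<times> W \<times> UNIV) (\<lambda>z. H (fst z) (fst (snd z)) (snd (snd z)) (snd (snd z)))"
proof -
  let ?S = "UNIV \<times> W \<times> (UNIV :: 'a set) :: ('b \<times> 'a \<times> 'a) set"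
  have w: "continuous_on ?S (\<lambda>z. fst (snd z))" "(\<lambda>z. fst (snd z)) ` ?S \<subseteq> W"
    by (auto intro!: continuous_intros)
  have 2: "continuous_on ?S (\<lambda>z. f2 b (fst (snd z)) a)" for a b
    using continuous_on_compose2[OF f2_cont w] .
  have 1: "continuous_on ?S (\<lambda>z. f1 (fst (snd z)) a)" for a
    using continuous_on_compose2[OF f1_cont w] .
  have 0: "continuous_on ?S (\<lambda>z. F (fst (snd z)))"
    using continuous_on_compose2[OF F_cont w] .
  have "continuous_on ?S (\<lambda>z. f2 b (fst (snd z)) a \<bullet> (F (fst (snd z)) - fst z))" for a b
    by (rule continuous_on_inner[OF 2 continuous_on_diff[OF 0]]) (intro continuous_intros)
  moreover have "continuous_on ?S (\<lambda>z. f1 (fst (snd z)) b \<bullet> f1 (fst (snd z)) a)" for a b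
    by (rule continuous_on_inner[OF 1 1])
  moreover have "continuous_on ?S (\<lambda>z. snd (snd z) \<bullet> a)" for a
    by (intro continuous_intros)
  ultimately show ?thesis
    unfolding H_def by (intro continuous_on_sum continuous_on_mult continuous_on_add)
qed

lemma line_in_W:
  assumes "w \<in> W" "v \<in> L"
  obtains r where "r > 0" "\<And>t. \<bar>t\<bar> < r \<Longrightarrow> w + t *\<^sub>R v \<in> W"
proof -
  obtain O' where O': "open O'" "W = L \<inter> O'" using W openin_open by blast
  have "open ((\<lambda>t. w + t *\<^sub>R v) -` O')"
    using O'(1) by (intro open_vimage continuous_intros)
  then obtain r where "r > 0" "ball 0 r \<subseteq> (\<lambda>t. w + t *\<^sub>R v) -` O'"
    using openE[of "(\<lambda>t. w + t *\<^sub>R v) -` O'" 0] assms(1) O'(2) by auto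
  then show ?thesis
    using assms O'(2) W_subset L
    by (intro that[of r]) (auto simp: subset_iff dist_real_def intro!: subspace_add subspace_scale)
qed

section \<open>Necessary conditions at a minimizer\<close>

lemma nearest_first_order:
  assumes w: "w \<in> W" and v: "v \<in> L" and min: "\<And>z. z \<in> W \<Longrightarrow> norm (F w - y) \<le> norm (F z - y)"
  shows "T w v \<bullet> (F w - y) = 0"
proof -
  obtain r where r: "r > 0" "\<And>t. \<bar>t\<bar> < r \<Longrightarrow> w + t *\<^sub>R v \<in> W"
    using line_in_W[OF w v] by blast
  have "w \<in> L" using w W_subset by blast
  have "2 * (T (w + 0 *\<^sub>R v) v \<bullet> (F (w + 0 *\<^sub>R v) - y)) = 0"
    by (rule DERIV_local_min[OF sq_line_deriv[OF \<open>w \<in> L\<close> v] \<open>r > 0\<close>])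
      (use r w min in \<open>auto intro!: power_mono\<close>)
  then show ?thesis by simp
qed

text \<open>A negative second derivative would make the first derivative, which vanishes at a
  minimizer, negative just to the right of 0, and the squared distance would drop below its
  minimum.\<close>

lemma nearest_second_order:
  assumes w: "w \<in> W" and v: "v \<in> L" and min: "\<And>z. z \<in> W \<Longrightarrow> norm (F w - y) \<le> norm (F z - y)"
  shows "H y w v v \<ge> 0"
proof (rule ccontr)
  assume "\<not> H y w v v \<ge> 0"
  then have neg: "2 * H y (w + 0 *\<^sub>R v) v v < 0" by simp
  obtain r where r: "r > 0" "\<And>t. \<bar>t\<bar> < r \<Longrightarrow> w + t *\<^sub>R v \<in> W"
    using line_in_W[OF w v] by blast
  have "w \<in> L" using w W_subset by blast
  note d1 = sq_line_deriv[OF \<open>w \<in> L\<close> v, of _ y] and d2 = sq_line_deriv2[OF \<open>w \<in> L\<close> v, of _ y]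
  have "w + 0 *\<^sub>R v \<in> W" using w by simp
  from DERIV_neg_dec_right[OF d2[OF this] neg]
  obtain d where d: "d > 0" "\<And>t. 0 < t \<Longrightarrow> t < d \<Longrightarrow>
      T (w + t *\<^sub>R v) v \<bullet> (F (w + t *\<^sub>R v) - y) < T w v \<bullet> (F w - y)"
    by auto
  define t where "t = min r d / 2"
  have t: "0 < t" "t < r" "t < d" using r d by (auto simp: t_def)
  have "\<exists>z. 0 < z \<and> z < t \<and> (norm (F (w + t *\<^sub>R v) - y))\<^sup>2 - (norm (F (w + 0 *\<^sub>R v) - y))\<^sup>2 =
      (t - 0) * (2 * (T (w + z *\<^sub>R v) v \<bullet> (F (w + z *\<^sub>R v) - y)))"
    by (rule MVT2[OF t(1)]) (use t r d1 in auto)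
  then obtain z where z: "0 < z" "z < t" "(norm (F (w + t *\<^sub>R v) - y))\<^sup>2 - (norm (F w - y))\<^sup>2 =
      t * (2 * (T (w + z *\<^sub>R v) v \<bullet> (F (w + z *\<^sub>R v) - y)))" by auto
  have "T (w + z *\<^sub>R v) v \<bullet> (F (w + z *\<^sub>R v) - y) < 0"
    using d(2)[of z] z t nearest_first_order[OF w v min] by simp
  then have "(norm (F (w + t *\<^sub>R v) - y))\<^sup>2 < (norm (F w - y))\<^sup>2"
    using z(3) t(1) mult_pos_neg[of t "2 * (T (w + z *\<^sub>R v) v \<bullet> (F (w + z *\<^sub>R v) - y))"] by linarith
  moreover have "norm (F w - y) \<le> norm (F (w + t *\<^sub>R v) - y)" using min r(2)[of t] t by simp
  ultimately show False by (meson norm_ge_zero not_less power_mono)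
qed

text \<open>For a positive semidefinite symmetric form, isotropic vectors lie in the kernel. This
  links failure of strict positivity to the bilinear condition in
  \<open>hessian_degenerate\<close>.\<close>

lemma H_kernel:
  assumes w: "w \<in> W" and min: "\<And>z. z \<in> W \<Longrightarrow> norm (F w - y) \<le> norm (F z - y)"
    and u: "u \<in> L" "H y w u u = 0" and v: "v \<in> L"
  shows "H y w v u = 0"
proof (rule ccontr)
  define \<alpha> \<beta> where "\<alpha> = H y w v u" and "\<beta> = H y w v v"
  assume "H y w v u \<noteq> 0"
  then have "\<alpha> \<noteq> 0" by (simp add: \<alpha>_def)
  have "\<beta> \<ge> 0" using nearest_second_order[OF w v min] by (simp add: \<beta>_def)
  \<comment> \<open>Nearly the minimizer of \<open>2 * s * \<alpha> + s * s * \<beta>\<close> over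
    \<open>s\<close>; the added 1 keeps the denominator positive when
    \<open>\<beta> = 0\<close>.\<close>
  define s where "s = - \<alpha> / (\<beta> + 1)"
  have "u + s *\<^sub>R v \<in> L" using u v L by (simp add: subspace_add subspace_scale)
  from nearest_second_order[OF w this min]
  have "0 \<le> 2 * s * \<alpha> + s * s * \<beta>"
    using u(2) H_sym[OF w, of y u v] by (simp add: H_add H_scale \<alpha>_def \<beta>_def algebra_simps)
  then have "0 \<le> (\<beta> + 1)\<^sup>2 * (2 * s * \<alpha> + s * s * \<beta>)" by simp
  also have "\<dots> = 2 * ((\<beta> + 1) * s) * \<alpha> * (\<beta> + 1) + ((\<beta> + 1) * s) * ((\<beta> + 1) * s) * \<beta>"
    by (simp add: power2_eq_square algebra_simps)
  also have "(\<beta> + 1) * s = - \<alpha>" using \<open>\<beta> \<ge> 0\<close> by (simp add: s_def)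
  also have "2 * (- \<alpha>) * \<alpha> * (\<beta> + 1) + (- \<alpha>) * (- \<alpha>) * \<beta> = - (\<alpha>\<^sup>2 * (\<beta> + 2))"
    by (simp add: power2_eq_square algebra_simps)
  also have "\<dots> < 0" using \<open>\<alpha> \<noteq> 0\<close> \<open>\<beta> \<ge> 0\<close> by simp
  finally show False by simp
qed

section \<open>Uniform positivity and quadratic growth\<close>

text \<open>The unit sphere of \<open>L\<close> is compact: a failing sequence of targets,
  parameters and unit directions has a subsequence converging to some \<open>(x, w0, l)\<close>,
  where joint continuity of \<open>H\<close> contradicts \<open>pos\<close>.\<close>

lemma uniformly_positive:
  assumes w0: "w0 \<in> W" and pos: "\<And>v. v \<in> L \<Longrightarrow> v \<noteq> 0 \<Longrightarrow> H x w0 v v > 0"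
  obtains c d where "c > 0" "d > 0"
    "\<And>y w v. dist y x < d \<Longrightarrow> w \<in> W \<Longrightarrow> dist w w0 < d \<Longrightarrow> v \<in> L \<Longrightarrow> c * (norm v)\<^sup>2 \<le> H y w v v"
proof (rule ccontr)
  note thesisI = that
  assume contr: "\<not> thesis"
  define e where "e n = inverse (real (Suc n))" for n
  have e: "e n > 0" "e \<longlonglongrightarrow> 0" for n
    unfolding e_def using LIMSEQ_inverse_real_of_nat by auto
  have "\<exists>y w v. dist y x < e n \<and> w \<in> W \<and> dist w w0 < e n \<and> v \<in> L \<and> norm v = 1 \<and> H y w v v < e n" for n
  proof -
    \<comment> \<open>The conclusion is denied for \<open>c = d = e n\<close>; quadratic homogeneity
      then permits rescaling \<open>v\<close> to length 1.\<close>
    obtain y w v where *: "dist y x < e n" "w \<in> W" "dist w w0 < e n" "v \<in> L"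
      "H y w v v < e n * (norm v)\<^sup>2"
      using thesisI[OF e(1) e(1), of n] contr by (meson not_le)
    have "v \<noteq> 0" using *(5) by (auto simp: H_def)
    define u where "u = inverse (norm v) *\<^sub>R v"
    have "H y w u u = H y w v v / (norm v)\<^sup>2"
      by (simp add: u_def H_scale power2_eq_square field_simps)
    then have "H y w u u < e n" using *(5) \<open>v \<noteq> 0\<close> by (simp add: pos_divide_less_eq)
    moreover have "norm u = 1" "u \<in> L"
      using \<open>v \<noteq> 0\<close> *(4) L by (auto simp: u_def subspace_scale)
    ultimately show ?thesis using * by blast
  qed
  then obtain y w v where yw: "\<And>n. dist (y n) x < e n" "\<And>n. w n \<in> W" "\<And>n. dist (w n) w0 < e n"
    and v: "\<And>n. v n \<in> L" "\<And>n. norm (v n) = 1" and H: "\<And>n. H (y n) (w n) (v n) (v n) < e n"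
    by metis
  have "compact (sphere 0 1 \<inter> L)" using closed_subspace[OF L] by (simp add: compact_Int_closed)
  moreover have "\<forall>n. v n \<in> sphere 0 1 \<inter> L" using v by simp
  ultimately obtain l r where l: "l \<in> sphere 0 1 \<inter> L" "strict_mono r" "(v \<circ> r) \<longlonglongrightarrow> l"
    unfolding compact_def by blast
  have "y \<longlonglongrightarrow> x" "w \<longlonglongrightarrow> w0"
    using metric_tendsto_imp_tendsto[OF e(2)] yw(1,3) e(1)
    by (auto intro!: metric_tendsto_imp_tendsto[OF e(2)] always_eventually simp: less_imp_le abs_of_pos)
  then have "(y \<circ> r) \<longlonglongrightarrow> x" "(w \<circ> r) \<longlonglongrightarrow> w0" "(e \<circ> r) \<longlonglongrightarrow> 0"
    using l(2) e(2) by (auto intro: LIMSEQ_subseq_LIMSEQ)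
  then have "((\<lambda>n. ((y \<circ> r) n, (w \<circ> r) n, (v \<circ> r) n))) \<longlonglongrightarrow> (x, w0, l)"
    using l(3) by (intro tendsto_Pair)
  from continuous_on_tendsto_compose[OF H_cont this]
  have "(\<lambda>n. H ((y \<circ> r) n) ((w \<circ> r) n) ((v \<circ> r) n) ((v \<circ> r) n)) \<longlonglongrightarrow> H x w0 l l"
    using w0 yw(2) by simp
  then have "H x w0 l l \<le> 0"
    using \<open>(e \<circ> r) \<longlonglongrightarrow> 0\<close> by (rule LIMSEQ_le) (use H in \<open>auto intro!: exI[of _ 0] less_imp_le\<close>)
  moreover have "l \<noteq> 0" using l(1) by auto
  ultimately show False using pos[of l] l(1) by simp
qed

lemma ball_in_W:
  assumes "w0 \<in> W"
  obtains d where "d > 0" "L \<inter> ball w0 d \<subseteq> W"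
proof -
  obtain O' where O': "open O'" "W = L \<inter> O'" using W openin_open by blast
  then show ?thesis using openE[of O' w0] assms that by (metis IntD2 Int_mono order_refl)
qed

text \<open>Second-order Taylor expansion on the segment from \<open>w\<close> to \<open>w'\<close>;
  the linear term vanishes because \<open>w\<close> is a minimizer for \<open>y\<close>. Since
  \<open>H\<close> is half the second derivative, the constant of uniform positivity is
  kept.\<close>

lemma quadratic_growth:
  assumes w0: "w0 \<in> W" and pos: "\<And>v. v \<in> L \<Longrightarrow> v \<noteq> 0 \<Longrightarrow> H x w0 v v > 0"
  obtains c d where "c > 0" "d > 0"
    "\<And>y w w'. dist y x < d \<Longrightarrow> w \<in> L \<inter> ball w0 d \<Longrightarrow> w' \<in> L \<inter> ball w0 d \<Longrightarrow>
       (\<And>z. z \<in> W \<Longrightarrow> norm (F w - y) \<le> norm (F z - y)) \<Longrightarrow>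
       (norm (F w - y))\<^sup>2 + c * (norm (w' - w))\<^sup>2 \<le> (norm (F w' - y))\<^sup>2"
proof -
  obtain c d where c: "c > 0" and d: "d > 0" and
    H: "\<And>y w v. dist y x < d \<Longrightarrow> w \<in> W \<Longrightarrow> dist w w0 < d \<Longrightarrow> v \<in> L \<Longrightarrow> c * (norm v)\<^sup>2 \<le> H y w v v"
    using uniformly_positive[OF assms] by blast
  obtain d' where d': "d' > 0" "L \<inter> ball w0 d' \<subseteq> W" using ball_in_W[OF w0] .
  show ?thesis
  proof (rule that[OF c, of "min d d'"])
    fix y w w'
    assume y: "dist y x < min d d'" and w: "w \<in> L \<inter> ball w0 (min d d')"
      and w': "w' \<in> L \<inter> ball w0 (min d d')"
      and min: "\<And>z. z \<in> W \<Longrightarrow> norm (F w - y) \<le> norm (F z - y)"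
    define v where "v = w' - w"
    have vL: "v \<in> L" and wL: "w \<in> L" using w w' L by (auto simp: v_def subspace_diff)
    have seg: "w + s *\<^sub>R v \<in> W \<and> dist (w + s *\<^sub>R v) w0 < d" if "0 \<le> s" "s \<le> 1" for s
    proof -
      have "(1 - s) *\<^sub>R w + s *\<^sub>R w' \<in> L \<inter> ball w0 (min d d')"
        using w w' that L by (intro convexD convex_Int subspace_imp_convex convex_ball) auto
      moreover have "(1 - s) *\<^sub>R w + s *\<^sub>R w' = w + s *\<^sub>R v" by (simp add: v_def algebra_simps)
      ultimately show ?thesis using d'(2) by (auto simp: dist_commute subset_iff)
    qed
    define h where "h = (\<lambda>t. (norm (F (w + t *\<^sub>R v) - y))\<^sup>2)"
    define h1 where "h1 = (\<lambda>t. 2 * (T (w + t *\<^sub>R v) v \<bullet> (F (w + t *\<^sub>R v) - y)))"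
    define h2 where "h2 = (\<lambda>t. 2 * H y (w + t *\<^sub>R v) v v)"
    \<comment> \<open>The derivatives of order 0, 1 and 2 are packed into one sequence, the format
      that \<open>Maclaurin\<close> expects.\<close>
    define k where "k m = (if m = 0 then h else if m = 1 then h1 else h2)" for m :: nat
    have "\<exists>t. 0 < t \<and> t < 1 \<and> h 1 = (\<Sum>m<2. k m 0 / fact m * 1 ^ m) + k 2 t / fact 2 * 1 ^ 2"
    proof (rule Maclaurin)
      show "\<forall>m t. m < 2 \<and> 0 \<le> t \<and> t \<le> 1 \<longrightarrow> (k m has_real_derivative k (Suc m) t) (at t)"
        using sq_line_deriv[OF wL vL] sq_line_deriv2[OF wL vL] seg
        by (auto simp: k_def h_def h1_def h2_def less_2_cases_iff)
    qed (auto simp: k_def)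
    then obtain t where t: "0 < t" "t < 1" "h 1 = h 0 + h1 0 + h2 t / 2"
      by (auto simp: k_def numeral_2_eq_2)
    have "h1 0 = 0"
      using nearest_first_order[of w v y] seg[of 0] vL min by (simp add: h1_def)
    moreover have "c * (norm v)\<^sup>2 \<le> h2 t / 2"
      using H[of y "w + t *\<^sub>R v" v] y seg[of t] t vL by (simp add: h2_def)
    ultimately show "(norm (F w - y))\<^sup>2 + c * (norm (w' - w))\<^sup>2 \<le> (norm (F w' - y))\<^sup>2"
      using t(3) by (simp add: h_def v_def)
  qed (use d d' in auto)
qed

text \<open>Serves to convert growth in the parameter into growth on the manifold.\<close>

lemma local_Lipschitz:
  assumes w0: "w0 \<in> W"
  obtains K d where "K > 0" "d > 0"
    "\<And>w w'. w \<in> L \<inter> ball w0 d \<Longrightarrow> w' \<in> L \<inter> ball w0 d \<Longrightarrow> norm (F w' - F w) \<le> K * norm (w' - w)"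
proof -
  \<comment> \<open>A bound for the operator norm that is continuous in \<open>w\<close>, because
    each summand is a derivative in a fixed direction.\<close>
  define N where "N w = (\<Sum>i\<in>Basis. norm (f1 w i))" for w
  have "continuous_on W N" unfolding N_def by (intro continuous_intros f1_cont)
  then obtain d1 where d1: "d1 > 0" "\<And>w. w \<in> W \<Longrightarrow> dist w w0 < d1 \<Longrightarrow> dist (N w) (N w0) < 1"
    using w0 unfolding continuous_on_iff by (metis zero_less_one)
  obtain d2 where d2: "d2 > 0" "L \<inter> ball w0 d2 \<subseteq> W" using ball_in_W[OF w0] .
  define S where "S = L \<inter> ball w0 (min d1 d2)"
  have S: "convex S" "S \<subseteq> W" unfolding S_def using L d2
    by (auto intro: convex_Int[OF subspace_imp_convex[OF L] convex_ball])
  have "N w0 \<ge> 0" unfolding N_def by (simp add: sum_nonneg)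
  have on: "onorm (f1 w) \<le> N w0 + 1" if "w \<in> S" for w
  proof -
    have "N w \<le> N w0 + 1"
      using d1(2)[of w] that S by (auto simp: S_def dist_real_def dist_commute)
    have "norm (f1 w v) \<le> N w * norm v" for v
    proof -
      have "f1 w v = (\<Sum>i\<in>Basis. (v \<bullet> i) *\<^sub>R f1 w i)"
        using linear_f1[of w] that S
        by (subst euclidean_representation[of v, symmetric])
          (auto simp: linear_sum linear_cmul)
      also have "norm \<dots> \<le> (\<Sum>i\<in>Basis. norm v * norm (f1 w i))"
        by (rule sum_norm_le) (simp add: Basis_le_norm mult_right_mono)
      finally show ?thesis by (simp add: N_def sum_distrib_left mult.commute)
    qed
    then have "onorm (f1 w) \<le> N w" by (rule onorm_le)
    then show ?thesis using \<open>N w \<le> N w0 + 1\<close> by simp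
  qed
  show ?thesis
  proof (rule that[of "N w0 + 1" "min d1 d2"])
    fix w w' assume "w \<in> L \<inter> ball w0 (min d1 d2)" "w' \<in> L \<inter> ball w0 (min d1 d2)"
    then have "w \<in> S" "w' \<in> S" by (auto simp: S_def)
    then show "norm (F w' - F w) \<le> (N w0 + 1) * norm (w' - w)"
      using S f1 on by (intro differentiable_bound[OF S(1)]) (auto intro: has_derivative_subset)
  qed (use d1 d2 \<open>N w0 \<ge> 0\<close> in auto)
qed

lemma sq_dist_has_derivative:
  assumes "w \<in> W"
  shows "((\<lambda>w. (norm (F w - y))\<^sup>2) has_derivative (\<lambda>v. 2 * (f1 w v \<bullet> (F w - y)))) (at w within W)"
proof -
  have "((\<lambda>w. (F w - y) \<bullet> (F w - y)) has_derivative
      (\<lambda>v. (F w - y) \<bullet> (f1 w v - 0) + (f1 w v - 0) \<bullet> (F w - y))) (at w within W)"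
    by (intro has_derivative_inner f1[OF assms] has_derivative_diff has_derivative_const)
  then show ?thesis
    unfolding power2_norm_eq_inner
    by (elim has_derivative_eq_rhs) (simp add: fun_eq_iff inner_commute)
qed

text \<open>Expanding \<open>v\<close> in \<open>E\<close> before differentiating again leaves only
  second derivatives of basis directions, the form in which \<open>H\<close> is built.\<close>

lemma sq_dist_has_derivative2:
  assumes w: "w0 \<in> W" and v: "v \<in> L"
  shows "((\<lambda>w. 2 * (f1 w v \<bullet> (F w - y))) has_derivative
     (\<lambda>u. \<Sum>b\<in>E. (v \<bullet> b) * (2 * (f2 b w0 u \<bullet> (F w0 - y) + f1 w0 b \<bullet> f1 w0 u)))) (at w0 within W)"
proof (rule has_derivative_transform[OF w])
  show "2 * (f1 w v \<bullet> (F w - y)) = (\<Sum>b\<in>E. (v \<bullet> b) * (2 * (f1 w b \<bullet> (F w - y))))" if "w \<in> W" for w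
    unfolding T_eq[OF that v] T_def by (simp add: inner_sum_left sum_distrib_left mult_ac)
  have "((\<lambda>w. f1 w b \<bullet> (F w - y)) has_derivative
      (\<lambda>u. f1 w0 b \<bullet> (f1 w0 u - 0) + f2 b w0 u \<bullet> (F w0 - y))) (at w0 within W)" for b
    by (intro has_derivative_inner f1[OF w] f2[OF w] has_derivative_diff has_derivative_const)
  then show "((\<lambda>w. \<Sum>b\<in>E. (v \<bullet> b) * (2 * (f1 w b \<bullet> (F w - y)))) has_derivative
     (\<lambda>u. \<Sum>b\<in>E. (v \<bullet> b) * (2 * (f2 b w0 u \<bullet> (F w0 - y) + f1 w0 b \<bullet> f1 w0 u)))) (at w0 within W)"
    by (intro has_derivative_sum has_derivative_mult_right) (simp add: add.commute)
qed

end

section \<open>Charts and degeneracy of the Hessian\<close>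

lemma chart_C2_patch:
  assumes "is_chart m M L W \<psi> U"
  obtains E f1 f2 where "C2_patch L W E \<psi> f1 f2"
proof -
  have L: "subspace L" and W: "openin (top_of_set L) W" and smooth: "smooth_on W \<psi>"
    using assms by (auto simp: is_chart_def)
  obtain E where E: "E \<subseteq> L" "pairwise orthogonal E" "\<And>x. x \<in> E \<Longrightarrow> norm x = 1"
    "independent E" "span E = L"
    using orthonormal_basis_subspace[OF L] by metis
  have fin: "finite E" using E(4) independent_imp_finite by blast
  \<comment> \<open>Order 2 unfolds to a first derivative, a second derivative for each direction
    \<open>v\<close>, and continuity of its values in each fixed direction; choice then collects
    these second derivatives into one function of \<open>v\<close>.\<close>
  have "Ck_on (Suc (Suc 0)) W \<psi>" using smooth unfolding smooth_on_def by blast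
  then obtain f1 where f1: "\<And>x. x \<in> W \<Longrightarrow> (\<psi> has_derivative f1 x) (at x within W)"
    and "\<forall>v. \<exists>f2. (\<forall>x\<in>W. ((\<lambda>x. f1 x v) has_derivative f2 x) (at x within W)) \<and>
            (\<forall>u. continuous_on W (\<lambda>x. f2 x u))"
    by auto
  then obtain f2 where
    f2: "\<And>v. (\<forall>x\<in>W. ((\<lambda>x. f1 x v) has_derivative f2 v x) (at x within W)) \<and>
            (\<forall>u. continuous_on W (\<lambda>x. f2 v x u))"
    by metis
  have "(\<Sum>e\<in>E. (v \<bullet> e) *\<^sub>R e) = v" if "v \<in> L" for v
    using orthonormal_basis_expand[of E v] E that fin by simp
  then have "C2_patch L W E \<psi> f1 f2"
    using L W E(1) fin f1 f2 by unfold_locales auto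
  then show ?thesis by (rule that)
qed

lemma (in C2_patch) degenerate_kernel:
  assumes "w0 \<in> W" and min: "\<And>z. z \<in> W \<Longrightarrow> norm (F w0 - y) \<le> norm (F z - y)"
    and u: "u \<in> L" "H y w0 u u = 0" and v: "v \<in> L"
  shows "(\<Sum>b\<in>E. (v \<bullet> b) * (2 * (f2 b w0 u \<bullet> (F w0 - y) + f1 w0 b \<bullet> f1 w0 u))) = 0"
proof -
  have "(\<Sum>b\<in>E. (v \<bullet> b) * (2 * (f2 b w0 u \<bullet> (F w0 - y) + f1 w0 b \<bullet> f1 w0 u))) = 2 * H y w0 v u"
    unfolding H_eq[OF assms(1) u(1)] T_eq[OF assms(1) u(1)]
    by (simp add: sum_distrib_left mult_ac)
  then show ?thesis using H_kernel[OF assms] by simp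
qed

text \<open>Minimality gives \<open>H \<ge> 0\<close>. Equality at \<open>u\<close> would make
  \<open>u\<close> a degenerate direction by the kernel argument, with the derivatives computed
  above as the witnesses \<open>g'\<close> and \<open>g''\<close>.\<close>

lemma nondegenerate_imp_H_pos:
  fixes L W E :: "(real^'n) set" and \<psi> :: "real^'n \<Rightarrow> real^'n"
  assumes patch: "C2_patch L W E \<psi> f1 f2" and w0: "w0 \<in> W"
    and min: "\<And>z. z \<in> W \<Longrightarrow> norm (\<psi> w0 - x) \<le> norm (\<psi> z - x)"
    and nd: "\<not> hessian_degenerate L W (\<lambda>w. (norm (\<psi> w - x))\<^sup>2) w0"
    and u: "u \<in> L" "u \<noteq> 0"
  shows "C2_patch.H E \<psi> f1 f2 x w0 u u > 0"
proof (rule ccontr)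
  interpret C2_patch L W E \<psi> f1 f2 by (rule patch)
  assume "\<not> H x w0 u u > 0"
  then have 0: "H x w0 u u = 0" using nearest_second_order[OF w0 u(1) min] by simp
  have "hessian_degenerate L W (\<lambda>w. (norm (\<psi> w - x))\<^sup>2) w0"
    unfolding hessian_degenerate_def
  proof (rule exI[of _ "\<lambda>w v. 2 * (f1 w v \<bullet> (\<psi> w - x))"],
      rule exI[of _ "\<lambda>v u. \<Sum>b\<in>E. (v \<bullet> b) * (2 * (f2 b w0 u \<bullet> (\<psi> w0 - x) + f1 w0 b \<bullet> f1 w0 u))"],
      intro conjI ballI bexI[of _ u])
    show "((\<lambda>w. (norm (\<psi> w - x))\<^sup>2) has_derivative (\<lambda>v. 2 * (f1 w v \<bullet> (\<psi> w - x)))) (at w within W)"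
      if "w \<in> W" for w
      using that by (rule sq_dist_has_derivative)
    show "((\<lambda>w. 2 * (f1 w v \<bullet> (\<psi> w - x))) has_derivative
     (\<lambda>u. \<Sum>b\<in>E. (v \<bullet> b) * (2 * (f2 b w0 u \<bullet> (\<psi> w0 - x) + f1 w0 b \<bullet> f1 w0 u)))) (at w0 within W)"
      if "v \<in> L" for v
      using w0 that by (rule sq_dist_has_derivative2)
    show "(\<Sum>b\<in>E. (v \<bullet> b) * (2 * (f2 b w0 u \<bullet> (\<psi> w0 - x) + f1 w0 b \<bullet> f1 w0 u))) = 0"
      if "v \<in> L" for v
      using w0 min u(1) 0 that by (rule degenerate_kernel)
  qed (use u in auto)
  with nd show False by simp
qed

section \<open>Quadratic growth and the complement of the cutlocus\<close>

definition strict_nearest :: "real \<Rightarrow> (real^'n) set \<Rightarrow> real^'n \<Rightarrow> real^'n \<Rightarrow> bool" where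
  "strict_nearest c M y \<nu> \<longleftrightarrow>
     \<nu> \<in> M \<and> (\<forall>\<nu>'\<in>M. (norm (\<nu> - y))\<^sup>2 + c * (norm (\<nu>' - \<nu>))\<^sup>2 \<le> (norm (\<nu>' - y))\<^sup>2)"

lemma strict_nearest_unique:
  assumes "c > 0" "strict_nearest c M y \<nu>"
  shows "is_nearest M y \<nu>'' \<longleftrightarrow> \<nu>'' = \<nu>"
proof
  assume "is_nearest M y \<nu>''"
  then have 1: "(norm (\<nu> - y))\<^sup>2 + c * (norm (\<nu>'' - \<nu>))\<^sup>2 \<le> (norm (\<nu>'' - y))\<^sup>2"
    and 2: "norm (\<nu>'' - y) \<le> norm (\<nu> - y)"
    using assms(2) by (simp_all add: strict_nearest_def is_nearest_def)
  have "c * (norm (\<nu>'' - \<nu>))\<^sup>2 \<le> 0"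
    using 1 power_mono[OF 2 norm_ge_zero, of 2] by linarith
  then show "\<nu>'' = \<nu>" using assms(1) by (simp add: mult_le_0_iff)
next
  assume "\<nu>'' = \<nu>"
  moreover have "norm (\<nu> - y) \<le> norm (\<nu>' - y)" if "\<nu>' \<in> M" for \<nu>'
  proof -
    have "0 \<le> c * (norm (\<nu>' - \<nu>))\<^sup>2" using assms(1) by simp
    moreover have "(norm (\<nu> - y))\<^sup>2 + c * (norm (\<nu>' - \<nu>))\<^sup>2 \<le> (norm (\<nu>' - y))\<^sup>2"
      using assms(2) that by (simp add: strict_nearest_def)
    ultimately have "(norm (\<nu> - y))\<^sup>2 \<le> (norm (\<nu>' - y))\<^sup>2" by linarith
    then show ?thesis by (rule power2_le_imp_le) simp
  qed
  ultimately show "is_nearest M y \<nu>''"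
    using assms(2) by (simp add: is_nearest_def strict_nearest_def)
qed

text \<open>Along a null direction u of the Hessian the squared distance grows like \<open>o(t\<^sup>2)\<close>, while the
  chart moves the point by at least a multiple of t, as its derivative is injective.\<close>

lemma strict_nearest_imp_nondegenerate:
  assumes c: "c > 0" and sn: "strict_nearest c M y (\<psi> w0)"
    and chart: "is_chart m M L W \<psi> U" and w0: "w0 \<in> W"
  shows "\<not> hessian_degenerate L W (\<lambda>w. (norm (\<psi> w - y))\<^sup>2) w0"
proof
  assume "hessian_degenerate L W (\<lambda>w. (norm (\<psi> w - y))\<^sup>2) w0"
  then obtain g' g'' u where
    g': "\<And>w. w \<in> W \<Longrightarrow> ((\<lambda>w. (norm (\<psi> w - y))\<^sup>2) has_derivative g' w) (at w within W)"
    and g'': "\<And>v. v \<in> L \<Longrightarrow> ((\<lambda>w. g' w v) has_derivative g'' v) (at w0 within W)"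
    and u: "u \<in> L" "u \<noteq> 0" "\<forall>v\<in>L. g'' v u = 0"
    unfolding hessian_degenerate_def by blast
  have L: "subspace L" and W: "openin (top_of_set L) W" using chart by (auto simp: is_chart_def)
  have "\<psi> ` W \<subseteq> M" using chart unfolding is_chart_def homeomorphism_def by blast
  have "w0 \<in> L" using W w0 openin_imp_subset by blast
  obtain A where A: "(\<psi> has_derivative A) (at w0 within W)" "inj_on A L"
    using chart w0 unfolding is_chart_def by blast
  have "A u \<noteq> 0"
    using linear_0[OF has_derivative_linear[OF A(1)]] inj_onD[OF A(2) _ u(1) subspace_0[OF L]] u(2)
    by auto
  obtain E f1 f2 where "C2_patch L W E \<psi> f1 f2" using chart_C2_patch[OF chart] .
  then obtain r where r: "r > 0" "\<And>t. \<bar>t\<bar> < r \<Longrightarrow> w0 + t *\<^sub>R u \<in> W"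
    using C2_patch.line_in_W[OF _ w0 u(1)] by blast
  define h where "h = (\<lambda>t. (norm (\<psi> (w0 + t *\<^sub>R u) - y))\<^sup>2)"
  define h1 where "h1 = (\<lambda>t. g' (w0 + t *\<^sub>R u) u)"
  have h: "(h has_real_derivative h1 t) (at t)" if "\<bar>t\<bar> < r" for t
    using has_vector_derivative_along_line[OF L W \<open>w0 \<in> L\<close> u(1) r(2)[OF that] g'[OF r(2)[OF that]]]
    by (simp add: h_def h1_def has_real_derivative_iff_has_vector_derivative)
  have "w0 + 0 *\<^sub>R u \<in> W" "((\<lambda>w. g' w u) has_derivative g'' u) (at (w0 + 0 *\<^sub>R u) within W)"
    using w0 g''[OF u(1)] by auto
  from has_vector_derivative_along_line[OF L W \<open>w0 \<in> L\<close> u(1) this]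
  \<comment> \<open>The degeneracy condition at \<open>v = u\<close> says that the second derivative
    of \<open>h\<close> at 0 vanishes.\<close>
  have h1: "(h1 has_derivative (\<lambda>t. 0)) (at 0)"
    using u(1,3) by (simp add: h1_def has_vector_derivative_def)
  have growth: "c * (norm (\<psi> (w0 + t *\<^sub>R u) - \<psi> w0))\<^sup>2 \<le> h t - h 0" if "\<bar>t\<bar> < r" for t
  proof -
    have "\<psi> (w0 + t *\<^sub>R u) \<in> M" using r(2)[OF that] \<open>\<psi> ` W \<subseteq> M\<close> by blast
    then have "(norm (\<psi> w0 - y))\<^sup>2 + c * (norm (\<psi> (w0 + t *\<^sub>R u) - \<psi> w0))\<^sup>2 \<le> h t"
      using sn by (simp add: strict_nearest_def h_def)
    then show ?thesis by (simp add: h_def)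
  qed
  have "h1 0 = 0"
  proof (rule DERIV_local_min[OF h \<open>r > 0\<close>])
    show "\<forall>t. \<bar>0 - t\<bar> < r \<longrightarrow> h 0 \<le> h t"
    proof (intro allI impI)
      fix t :: real assume "\<bar>0 - t\<bar> < r"
      then have "c * (norm (\<psi> (w0 + t *\<^sub>R u) - \<psi> w0))\<^sup>2 \<le> h t - h 0" by (simp add: growth)
      moreover have "0 \<le> c * (norm (\<psi> (w0 + t *\<^sub>R u) - \<psi> w0))\<^sup>2" using c by simp
      ultimately show "h 0 \<le> h t" by linarith
    qed
  qed (use r in simp)
  \<comment> \<open>For small \<open>t > 0\<close> the chart moves the point by at least
    \<open>t * (norm (A u) / 2)\<close>, so growth forces
    \<open>h t - h 0 \<ge> 2 * e * t * t\<close>, whereas the vanishing derivative of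
    \<open>h1\<close> allows at most \<open>e * t * t\<close>.\<close>
  define e where "e = c * (norm (A u) / 2)\<^sup>2 / 2"
  have "e > 0" using c \<open>A u \<noteq> 0\<close> by (simp add: e_def)
  obtain d1 where d1: "d1 > 0" "\<And>z. \<bar>z\<bar> < d1 \<Longrightarrow> \<bar>h1 z\<bar> \<le> e * \<bar>z\<bar>"
  proof -
    have "\<exists>d>0. \<forall>z. norm (z - 0) < d \<longrightarrow> norm (h1 z - h1 0 - 0) \<le> e * norm (z - 0)"
      using h1 \<open>e > 0\<close> unfolding has_derivative_at_alt by blast
    then show ?thesis using that \<open>h1 0 = 0\<close> by auto
  qed
  have "w0 + 0 *\<^sub>R u \<in> W" "(\<psi> has_derivative A) (at (w0 + 0 *\<^sub>R u) within W)"
    using w0 A by auto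
  from has_vector_derivative_along_line[OF L W \<open>w0 \<in> L\<close> u(1) this]
  have "((\<lambda>t. \<psi> (w0 + t *\<^sub>R u)) has_derivative (\<lambda>t. t *\<^sub>R A u)) (at 0)"
    by (simp add: has_vector_derivative_def)
  moreover have "norm (A u) / 2 > 0" using \<open>A u \<noteq> 0\<close> by simp
  ultimately have "\<exists>d>0. \<forall>z. norm (z - 0) < d \<longrightarrow>
      norm (\<psi> (w0 + z *\<^sub>R u) - \<psi> (w0 + 0 *\<^sub>R u) - (z - 0) *\<^sub>R A u) \<le> norm (A u) / 2 * norm (z - 0)"
    unfolding has_derivative_at_alt by blast
  then obtain d2 where d2: "d2 > 0" "\<And>z. \<bar>z\<bar> < d2 \<Longrightarrow>
      norm (\<psi> (w0 + z *\<^sub>R u) - \<psi> w0 - z *\<^sub>R A u) \<le> norm (A u) / 2 * \<bar>z\<bar>"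
    by auto
  define t where "t = min r (min d1 d2) / 2"
  have t: "0 < t" "t < r" "t < d1" "t < d2" using r d1 d2 by (auto simp: t_def)
  have "\<exists>z. 0 < z \<and> z < t \<and> h t - h 0 = (t - 0) * h1 z"
    by (rule MVT2[OF t(1)]) (use t h in auto)
  then obtain z where z: "0 < z" "z < t" "h t - h 0 = t * h1 z" by auto
  have "h1 z \<le> e * z" using d1(2)[of z] z t by auto
  also have "\<dots> \<le> e * t" using z \<open>e > 0\<close> by simp
  finally have "h t - h 0 \<le> t * (e * t)" using z(3) t(1) by simp
  have "norm (t *\<^sub>R A u) \<le> norm (\<psi> (w0 + t *\<^sub>R u) - \<psi> w0) + norm (\<psi> (w0 + t *\<^sub>R u) - \<psi> w0 - t *\<^sub>R A u)"
    using norm_triangle_ineq4[of "\<psi> (w0 + t *\<^sub>R u) - \<psi> w0" "\<psi> (w0 + t *\<^sub>R u) - \<psi> w0 - t *\<^sub>R A u"]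
    by simp
  then have "t * (norm (A u) / 2) \<le> norm (\<psi> (w0 + t *\<^sub>R u) - \<psi> w0)"
    using d2(2)[of t] t by (simp add: field_simps)
  then have "(t * (norm (A u) / 2))\<^sup>2 \<le> (norm (\<psi> (w0 + t *\<^sub>R u) - \<psi> w0))\<^sup>2"
    using t by (intro power_mono) auto
  then have "c * (t * (norm (A u) / 2))\<^sup>2 \<le> c * (norm (\<psi> (w0 + t *\<^sub>R u) - \<psi> w0))\<^sup>2"
    using c by simp
  also have "\<dots> \<le> t * (e * t)"
    using growth[of t] t \<open>h t - h 0 \<le> t * (e * t)\<close> by simp
  also have "c * (t * (norm (A u) / 2))\<^sup>2 = t * (2 * e * t)"
    by (simp add: e_def power2_eq_square)
  finally show False using t(1) \<open>e > 0\<close> by simp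
qed

text \<open>Any chart around the nearest point may witness membership in the cutlocus, so degeneracy
  has to be refuted in every chart.\<close>

lemma strict_nearest_imp_notin_cutlocus:
  assumes "c > 0" "strict_nearest c M y \<nu>"
  shows "y \<notin> cutlocus m M"
proof -
  have "\<exists>!\<mu>. is_nearest M y \<mu>"
    unfolding strict_nearest_unique[OF assms] by blast
  moreover have "\<not> hessian_degenerate L W (\<lambda>w. (norm (\<psi> w - y))\<^sup>2) w0"
    if "is_nearest M y \<mu>" "is_chart m M L W \<psi> U" "w0 \<in> W" "\<psi> w0 = \<mu>" for \<mu> L W \<psi> U w0
    using strict_nearest_imp_nondegenerate[OF assms(1) _ that(2,3)] assms that
    unfolding strict_nearest_unique[OF assms] by blast
  ultimately show ?thesis unfolding cutlocus_def by blast
qed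

lemma is_nearest_nearest_point:
  assumes "x \<notin> cutlocus m M"
  shows "is_nearest M x (nearest_point M x)"
  using assms unfolding cutlocus_def nearest_point_def by (auto intro: theI')

lemma nearest_point_eq:
  assumes "x \<notin> cutlocus m M" "is_nearest M x \<mu>"
  shows "nearest_point M x = \<mu>"
  using assms is_nearest_nearest_point[OF assms(1)] unfolding cutlocus_def by blast

lemma nearest_exists:
  assumes "compact M" "M \<noteq> {}"
  obtains \<nu> where "is_nearest M y \<nu>"
proof -
  have "continuous_on M (\<lambda>\<nu>. norm (\<nu> - y))" by (intro continuous_intros)
  then obtain \<nu> where "\<nu> \<in> M" "\<forall>\<nu>'\<in>M. norm (\<nu> - y) \<le> norm (\<nu>' - y)"
    using continuous_attains_inf[OF assms] by blast
  then show ?thesis using that by (simp add: is_nearest_def)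
qed

text \<open>The growth estimate in one chart around \<open>\<mu>\<close> is carried over to
  \<open>M\<close>: continuity of the chart inverse keeps the parameters close to \<open>w0\<close>,
  and the Lipschitz bound compares distances.\<close>

lemma strict_nearest_near:
  assumes M: "smooth_compact_submanifold m M" and x: "x \<notin> cutlocus m M" and \<mu>: "is_nearest M x \<mu>"
  obtains c d where "c > 0" "d > 0"
    "\<And>y \<nu> \<nu>'. dist y x < d \<Longrightarrow> is_nearest M y \<nu> \<Longrightarrow> dist \<nu> \<mu> < d \<Longrightarrow> \<nu>' \<in> M \<Longrightarrow> dist \<nu>' \<mu> < d \<Longrightarrow>
       (norm (\<nu> - y))\<^sup>2 + c * (norm (\<nu>' - \<nu>))\<^sup>2 \<le> (norm (\<nu>' - y))\<^sup>2"
proof -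
  have "\<mu> \<in> M" using \<mu> by (simp add: is_nearest_def)
  then obtain L W \<psi> U where chart: "is_chart m M L W \<psi> U" and "\<mu> \<in> U"
    using M unfolding smooth_compact_submanifold_def by blast
  then obtain \<phi> where hom: "homeomorphism W (M \<inter> U) \<psi> \<phi>" and "open U"
    unfolding is_chart_def by blast
  have W: "openin (top_of_set L) W" using chart by (simp add: is_chart_def)
  then have "W \<subseteq> L" by (rule openin_imp_subset)
  define w0 where "w0 = \<phi> \<mu>"
  have w0: "w0 \<in> W" "\<psi> w0 = \<mu>"
    using hom \<open>\<mu> \<in> M\<close> \<open>\<mu> \<in> U\<close> by (auto simp: homeomorphism_def w0_def)
  have sub: "\<psi> ` W \<subseteq> M" using hom by (auto simp: homeomorphism_def)
  obtain E f1 f2 where patch: "C2_patch L W E \<psi> f1 f2" using chart_C2_patch[OF chart] .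
  interpret C2_patch L W E \<psi> f1 f2 by (rule patch)
  have "\<not> hessian_degenerate L W (\<lambda>w. (norm (\<psi> w - x))\<^sup>2) w0"
    using x \<mu> chart w0 unfolding cutlocus_def by blast
  then have pos: "H x w0 v v > 0" if "v \<in> L" "v \<noteq> 0" for v
    using that \<mu> w0 sub
    by (intro nondegenerate_imp_H_pos[OF patch]) (auto simp: is_nearest_def)
  obtain c d1 where c: "c > 0" "d1 > 0" and
    growth: "\<And>y w w'. dist y x < d1 \<Longrightarrow> w \<in> L \<inter> ball w0 d1 \<Longrightarrow> w' \<in> L \<inter> ball w0 d1 \<Longrightarrow>
       (\<And>z. z \<in> W \<Longrightarrow> norm (\<psi> w - y) \<le> norm (\<psi> z - y)) \<Longrightarrow>
       (norm (\<psi> w - y))\<^sup>2 + c * (norm (w' - w))\<^sup>2 \<le> (norm (\<psi> w' - y))\<^sup>2"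
    using quadratic_growth[OF w0(1) pos] by blast
  obtain K d2 where K: "K > 0" "d2 > 0" and
    Lip: "\<And>w w'. w \<in> L \<inter> ball w0 d2 \<Longrightarrow> w' \<in> L \<inter> ball w0 d2 \<Longrightarrow> norm (\<psi> w' - \<psi> w) \<le> K * norm (w' - w)"
    using local_Lipschitz[OF w0(1)] by blast
  have "continuous_on (M \<inter> U) \<phi>" using hom by (simp add: homeomorphism_def)
  moreover have "min d1 d2 > 0" using c K by simp
  ultimately obtain d3 where d3: "d3 > 0"
    "\<And>\<nu>. \<nu> \<in> M \<inter> U \<Longrightarrow> dist \<nu> \<mu> < d3 \<Longrightarrow> dist (\<phi> \<nu>) w0 < min d1 d2"
    using \<open>\<mu> \<in> M\<close> \<open>\<mu> \<in> U\<close> unfolding continuous_on_iff w0_def by blast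
  obtain d4 where d4: "d4 > 0" "ball \<mu> d4 \<subseteq> U" using \<open>open U\<close> \<open>\<mu> \<in> U\<close> openE by blast
  define d where "d = min d1 (min d3 d4)"
  show ?thesis
  \<comment> \<open>\<open>norm (\<nu>' - \<nu>)\<close> is at most \<open>K\<close> times the
    parameter distance, so the growth constant loses a factor \<open>K\<^sup>2\<close>.\<close>
  proof (rule that[of "c / K\<^sup>2" d])
    fix y \<nu> \<nu>'
    assume y: "dist y x < d" and \<nu>: "is_nearest M y \<nu>" "dist \<nu> \<mu> < d" and \<nu>': "\<nu>' \<in> M" "dist \<nu>' \<mu> < d"
    have "\<nu> \<in> M" using \<nu> by (simp add: is_nearest_def)
    have "\<nu> \<in> M \<inter> U" "\<nu>' \<in> M \<inter> U"
      using \<nu>(2) \<nu>' \<open>\<nu> \<in> M\<close> d4 by (auto simp: d_def dist_commute subset_iff)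
    then have \<phi>: "\<phi> \<nu> \<in> L" "\<phi> \<nu>' \<in> L" "\<psi> (\<phi> \<nu>) = \<nu>" "\<psi> (\<phi> \<nu>') = \<nu>'"
      "dist (\<phi> \<nu>) w0 < min d1 d2" "dist (\<phi> \<nu>') w0 < min d1 d2"
      using hom \<open>W \<subseteq> L\<close> d3(2) \<nu>(2) \<nu>'(2) by (auto simp: homeomorphism_def d_def)
    have "norm (\<psi> (\<phi> \<nu>) - y) \<le> norm (\<psi> z - y)" if "z \<in> W" for z
      using \<nu>(1) sub that \<phi>(3) by (auto simp: is_nearest_def)
    then have 1: "(norm (\<nu> - y))\<^sup>2 + c * (norm (\<phi> \<nu>' - \<phi> \<nu>))\<^sup>2 \<le> (norm (\<nu>' - y))\<^sup>2"
      using growth[of y "\<phi> \<nu>" "\<phi> \<nu>'"] y \<phi> by (simp add: d_def dist_commute)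
    have "norm (\<nu>' - \<nu>) \<le> K * norm (\<phi> \<nu>' - \<phi> \<nu>)"
      using Lip[of "\<phi> \<nu>" "\<phi> \<nu>'"] \<phi> by (simp add: dist_commute)
    then have "(norm (\<nu>' - \<nu>))\<^sup>2 \<le> (K * norm (\<phi> \<nu>' - \<phi> \<nu>))\<^sup>2" by (intro power_mono) auto
    then have "c / K\<^sup>2 * (norm (\<nu>' - \<nu>))\<^sup>2 \<le> c / K\<^sup>2 * (K * norm (\<phi> \<nu>' - \<phi> \<nu>))\<^sup>2"
      using c by (intro mult_left_mono) auto
    also have "\<dots> = c * (norm (\<phi> \<nu>' - \<phi> \<nu>))\<^sup>2" using K by (simp add: power_mult_distrib)
    finally show "(norm (\<nu> - y))\<^sup>2 + c / K\<^sup>2 * (norm (\<nu>' - \<nu>))\<^sup>2 \<le> (norm (\<nu>' - y))\<^sup>2"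
      using 1 by simp
  qed (use c K d3 d4 in \<open>auto simp: d_def\<close>)
qed

text \<open>Near the foot point the local estimate applies. The rest of \<open>M\<close> is compact
  and misses the unique foot point, so it is farther from \<open>x\<close> by a fixed gap, which
  survives small changes of \<open>x\<close>.\<close>

lemma notin_cutlocus_imp_strict_nearest:
  assumes M: "smooth_compact_submanifold m M" and x: "x \<notin> cutlocus m M"
  obtains c d where "c > 0" "d > 0" "\<And>y. dist y x < d \<Longrightarrow> \<exists>\<nu>. strict_nearest c M y \<nu>"
proof -
  define \<mu> where "\<mu> = nearest_point M x"
  have \<mu>: "is_nearest M x \<mu>" unfolding \<mu>_def using x by (rule is_nearest_nearest_point)
  then have "\<mu> \<in> M" by (simp add: is_nearest_def)
  have comp: "compact M" using M by (simp add: smooth_compact_submanifold_def)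
  obtain c d where c: "c > 0" and d: "d > 0" and
    near: "\<And>y \<nu> \<nu>'. dist y x < d \<Longrightarrow> is_nearest M y \<nu> \<Longrightarrow> dist \<nu> \<mu> < d \<Longrightarrow> \<nu>' \<in> M \<Longrightarrow> dist \<nu>' \<mu> < d \<Longrightarrow>
       (norm (\<nu> - y))\<^sup>2 + c * (norm (\<nu>' - \<nu>))\<^sup>2 \<le> (norm (\<nu>' - y))\<^sup>2"
    using strict_nearest_near[OF M x \<mu>] by blast
  \<comment> \<open>Moving from \<open>x\<close> to \<open>y\<close> costs at most \<open>e\<close>
    on each side, so \<open>4 * e\<close> leaves the \<open>2 * e\<close> used below.\<close>
  have gap: "\<exists>e>0. \<forall>\<nu>\<in>M - ball \<mu> d. norm (\<mu> - x) + 4 * e \<le> norm (\<nu> - x)"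
  proof (cases "M - ball \<mu> d = {}")
    case True
    then show ?thesis by (intro exI[of _ 1]) auto
  next
    case False
    have "compact (M - ball \<mu> d)" using comp by (simp add: compact_diff)
    then obtain k where k: "is_nearest (M - ball \<mu> d) x k" using nearest_exists False by blast
    have "k \<noteq> \<mu>" using k d by (auto simp: is_nearest_def)
    then have "\<not> is_nearest M x k"
      using nearest_point_eq[OF x, of k] by (auto simp: \<mu>_def)
    then have "norm (\<mu> - x) < norm (k - x)"
      using k \<mu> unfolding is_nearest_def by (meson Diff_iff not_le order_trans)
    then show ?thesis
      using k by (intro exI[of _ "(norm (k - x) - norm (\<mu> - x)) / 4"]) (simp add: is_nearest_def field_simps)
  qed
  then obtain e where e: "e > 0" "\<And>\<nu>. \<nu> \<in> M \<Longrightarrow> \<not> dist \<nu> \<mu> < d \<Longrightarrow> norm (\<mu> - x) + 4 * e \<le> norm (\<nu> - x)"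
    by (auto simp: dist_commute)
  obtain R where R: "R > 0" "\<And>a b. a \<in> M \<Longrightarrow> b \<in> M \<Longrightarrow> norm (a - b) \<le> R"
  proof -
    obtain R where "R > 0" and R: "\<forall>a\<in>M. norm a \<le> R" using compact_imp_bounded[OF comp] bounded_pos by blast
    then have "norm (a - b) \<le> 2 * R" if "a \<in> M" "b \<in> M" for a b
      using norm_triangle_ineq4[of a b] R that by (smt (verit))
    then show ?thesis using that[of "2 * R"] \<open>R > 0\<close> by simp
  qed
  \<comment> \<open>For far points the gap yields a surplus of at least \<open>4 * e\<^sup>2\<close>
    in the squared distance; dividing by the square of the diameter bound \<open>R\<close> makes it
    dominate the growth term.\<close>
  define c' where "c' = min c (4 * e\<^sup>2 / R\<^sup>2)"
  show ?thesis
  proof (rule that[of c' "min d e"])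
    show "c' > 0" "min d e > 0" using c d e R by (auto simp: c'_def)
    fix y assume y: "dist y x < min d e"
    obtain \<nu> where \<nu>: "is_nearest M y \<nu>" using nearest_exists[OF comp] \<open>\<mu> \<in> M\<close> by blast
    have "\<nu> \<in> M" and le: "norm (\<nu> - y) \<le> norm (\<mu> - y)"
      using \<nu> \<open>\<mu> \<in> M\<close> by (auto simp: is_nearest_def)
    have "norm (x - y) < e" using y by (simp add: dist_norm norm_minus_commute)
    have far: "norm (\<mu> - y) + 2 * e \<le> norm (\<nu>' - y)" if "\<nu>' \<in> M" "\<not> dist \<nu>' \<mu> < d" for \<nu>'
      using e(2)[OF that] norm_triangle_ineq[of "\<mu> - x" "x - y"] norm_triangle_ineq4[of "\<nu>' - y" "x - y"]
        \<open>norm (x - y) < e\<close> by simp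
    \<comment> \<open>A far point loses to \<open>\<mu>\<close> itself, so the nearest point of
      \<open>y\<close> lies in the range of the local estimate.\<close>
    have "dist \<nu> \<mu> < d" using far[of \<nu>] \<open>\<nu> \<in> M\<close> le e(1) by fastforce
    have "(norm (\<nu> - y))\<^sup>2 + c' * (norm (\<nu>' - \<nu>))\<^sup>2 \<le> (norm (\<nu>' - y))\<^sup>2" if \<nu>': "\<nu>' \<in> M" for \<nu>'
    proof (cases "dist \<nu>' \<mu> < d")
      case True
      have "c' * (norm (\<nu>' - \<nu>))\<^sup>2 \<le> c * (norm (\<nu>' - \<nu>))\<^sup>2"
        by (intro mult_right_mono) (auto simp: c'_def)
      then show ?thesis using near[OF _ \<nu> \<open>dist \<nu> \<mu> < d\<close> \<nu>' True] y by simp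
    next
      case False
      have "(norm (\<nu> - y) + 2 * e)\<^sup>2 \<le> (norm (\<nu>' - y))\<^sup>2"
        using far[OF \<nu>' False] le e(1) by (intro power_mono) auto
      moreover have "(norm (\<nu> - y) + 2 * e)\<^sup>2 = (norm (\<nu> - y))\<^sup>2 + 4 * e * norm (\<nu> - y) + 4 * e\<^sup>2"
        by (simp add: power2_eq_square algebra_simps)
      moreover have "c' * (norm (\<nu>' - \<nu>))\<^sup>2 \<le> (4 * e\<^sup>2 / R\<^sup>2) * R\<^sup>2"
        using R(2)[OF \<nu>' \<open>\<nu> \<in> M\<close>] \<open>c' > 0\<close> by (intro mult_mono power_mono) (auto simp: c'_def)
      moreover have "(4 * e\<^sup>2 / R\<^sup>2) * R\<^sup>2 = 4 * e\<^sup>2" using R(1) by simp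
      moreover have "0 \<le> 4 * e * norm (\<nu> - y)" using e(1) by simp
      ultimately show ?thesis by linarith
    qed
    then show "\<exists>\<nu>. strict_nearest c' M y \<nu>" using \<open>\<nu> \<in> M\<close> by (auto simp: strict_nearest_def)
  qed
qed

lemma closed_cutlocus:
  assumes "smooth_compact_submanifold m M"
  shows "closed (cutlocus m M)"
proof -
  have "\<exists>d>0. \<forall>y. dist y x < d \<longrightarrow> y \<in> - cutlocus m M" if "x \<in> - cutlocus m M" for x
  proof -
    obtain c d where "c > 0" "d > 0" "\<And>y. dist y x < d \<Longrightarrow> \<exists>\<nu>. strict_nearest c M y \<nu>"
      using notin_cutlocus_imp_strict_nearest[OF assms, of x] \<open>x \<in> - cutlocus m M\<close> by blast
    then show ?thesis
      using strict_nearest_imp_notin_cutlocus by (intro exI[of _ d]) blast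
  qed
  then show ?thesis unfolding closed_def open_dist by blast
qed

section \<open>Nearest points along rays and the perturbation bound\<close>

text \<open>Expanding the squares leaves for each \<open>\<nu>\<close> a condition linear in
  \<open>k\<close>: the admissible \<open>k\<close> form a closed set, and slack in the inequality
  is room for larger \<open>k\<close>.\<close>

lemma is_nearest_on_ray:
  "is_nearest M (\<mu> + k *\<^sub>R (x - \<mu>)) \<mu> \<longleftrightarrow>
     \<mu> \<in> M \<and> (\<forall>\<nu>\<in>M. 2 * k * ((\<nu> - \<mu>) \<bullet> (x - \<mu>)) \<le> (norm (\<nu> - \<mu>))\<^sup>2)"
proof -
  let ?z = "\<mu> + k *\<^sub>R (x - \<mu>)"
  have "norm (\<mu> - ?z) \<le> norm (\<nu> - ?z) \<longleftrightarrow> 2 * k * ((\<nu> - \<mu>) \<bullet> (x - \<mu>)) \<le> (norm (\<nu> - \<mu>))\<^sup>2" for \<nu>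
  proof -
    have "(norm (\<nu> - ?z))\<^sup>2 = (norm (\<nu> - \<mu>))\<^sup>2 - 2 * k * ((\<nu> - \<mu>) \<bullet> (x - \<mu>)) + (norm (\<mu> - ?z))\<^sup>2"
      unfolding power2_norm_eq_inner by (simp add: inner_diff_left inner_diff_right inner_add_left
          inner_add_right inner_commute algebra_simps)
    moreover have "norm (\<mu> - ?z) \<le> norm (\<nu> - ?z) \<longleftrightarrow> (norm (\<mu> - ?z))\<^sup>2 \<le> (norm (\<nu> - ?z))\<^sup>2"
      by simp
    ultimately show ?thesis by linarith
  qed
  then show ?thesis unfolding is_nearest_def by blast
qed

text \<open>Continuity argument: at the largest admissible factor \<open>l\<close> in
  \<open>[1, \<Lambda>]\<close> the point is off the cutlocus, so quadratic growth leaves slack and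
  \<open>l\<close> could be enlarged unless \<open>l = \<Lambda>\<close>.\<close>

lemma nearest_extends_along_ray:
  assumes M: "smooth_compact_submanifold m M" and \<mu>: "is_nearest M x \<mu>" and \<Lambda>: "1 \<le> \<Lambda>"
    and avoid: "\<And>k. 1 \<le> k \<Longrightarrow> k \<le> \<Lambda> \<Longrightarrow> \<mu> + k *\<^sub>R (x - \<mu>) \<notin> cutlocus m M"
  shows "is_nearest M (\<mu> + \<Lambda> *\<^sub>R (x - \<mu>)) \<mu>"
proof -
  have "\<mu> \<in> M" using \<mu> by (simp add: is_nearest_def)
  define S where "S = {1..\<Lambda>} \<inter> (\<Inter>\<nu>\<in>M. {k. 2 * k * ((\<nu> - \<mu>) \<bullet> (x - \<mu>)) \<le> (norm (\<nu> - \<mu>))\<^sup>2})"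
  have "compact S"
    unfolding S_def by (intro compact_Int_closed closed_INT ballI closed_Collect_le continuous_intros) auto
  moreover have "1 \<in> S"
    using is_nearest_on_ray[of M \<mu> 1 x] \<mu> \<Lambda> by (simp add: S_def)
  ultimately obtain l where l: "l \<in> S" "\<And>k. k \<in> S \<Longrightarrow> k \<le> l"
    using compact_attains_sup[of S] by blast
  have l1: "1 \<le> l" "l \<le> \<Lambda>" using l(1) by (auto simp: S_def)
  have near: "is_nearest M (\<mu> + l *\<^sub>R (x - \<mu>)) \<mu>"
    using l(1) \<open>\<mu> \<in> M\<close> unfolding is_nearest_on_ray by (auto simp: S_def)
  obtain c d where cd: "c > 0" "d > 0"
    "\<And>y. dist y (\<mu> + l *\<^sub>R (x - \<mu>)) < d \<Longrightarrow> \<exists>\<nu>. strict_nearest c M y \<nu>"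
    using notin_cutlocus_imp_strict_nearest[OF M avoid[OF l1]] by blast
  obtain \<nu>0 where sn0: "strict_nearest c M (\<mu> + l *\<^sub>R (x - \<mu>)) \<nu>0" using cd(2,3) by fastforce
  then have sn: "strict_nearest c M (\<mu> + l *\<^sub>R (x - \<mu>)) \<mu>"
    using near strict_nearest_unique[OF cd(1) sn0] by simp
  \<comment> \<open>Growth with constant \<open>b\<close> sharpens the ray condition at
    \<open>l\<close> by a factor \<open>1 - b\<close>, so the condition still holds at
    \<open>l / (1 - b)\<close>. The cap \<open>1/2\<close> keeps \<open>1 - b\<close>
    positive.\<close>
  define b where "b = min c (1/2)"
  define l' where "l' = min \<Lambda> (l / (1 - b))"
  have b: "0 < b" "b < 1" "b \<le> c" using cd(1) by (auto simp: b_def)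
  have "l' \<in> S"
    unfolding S_def
  proof (intro IntI INT_I CollectI)
    have "l \<le> l / (1 - b)" using b l1 by (simp add: field_simps)
    then have "1 \<le> l / (1 - b)" using l1 by linarith
    then show "l' \<in> {1..\<Lambda>}" using \<Lambda> by (simp add: l'_def)
    fix \<nu> assume "\<nu> \<in> M"
    let ?p = "(\<nu> - \<mu>) \<bullet> (x - \<mu>)"
    let ?z = "\<mu> + l *\<^sub>R (x - \<mu>)"
    have "(norm (\<mu> - ?z))\<^sup>2 + c * (norm (\<nu> - \<mu>))\<^sup>2 \<le> (norm (\<nu> - ?z))\<^sup>2"
      using sn \<open>\<nu> \<in> M\<close> by (simp add: strict_nearest_def)
    moreover have "(norm (\<nu> - ?z))\<^sup>2 = (norm (\<nu> - \<mu>))\<^sup>2 - 2 * l * ?p + (norm (\<mu> - ?z))\<^sup>2"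
      unfolding power2_norm_eq_inner by (simp add: inner_diff_left inner_diff_right inner_add_left
          inner_add_right inner_commute algebra_simps)
    moreover have "b * (norm (\<nu> - \<mu>))\<^sup>2 \<le> c * (norm (\<nu> - \<mu>))\<^sup>2"
      using b by (intro mult_right_mono) auto
    ultimately have "2 * l * ?p \<le> (1 - b) * (norm (\<nu> - \<mu>))\<^sup>2" by (simp add: algebra_simps)
    then have *: "2 * (l / (1 - b)) * ?p \<le> (norm (\<nu> - \<mu>))\<^sup>2"
      using b by (simp add: field_simps)
    \<comment> \<open>Passing from \<open>l / (1 - b)\<close> down to \<open>l'\<close> preserves
      the inequality when \<open>?p \<ge> 0\<close>; otherwise the left side is not positive
      anyway.\<close>
    show "2 * l' * ?p \<le> (norm (\<nu> - \<mu>))\<^sup>2"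
    proof (cases "?p \<ge> 0")
      case True
      then have "2 * l' * ?p \<le> 2 * (l / (1 - b)) * ?p"
        by (intro mult_right_mono) (auto simp: l'_def)
      with * show ?thesis by linarith
    next
      case False
      then have "2 * l' * ?p \<le> 0"
        using \<open>1 \<le> l / (1 - b)\<close> \<Lambda> by (intro mult_nonneg_nonpos) (auto simp: l'_def)
      then show ?thesis using zero_le_power2[of "norm (\<nu> - \<mu>)"] by linarith
    qed
  qed
  then have "l' \<le> l" by (rule l(2))
  moreover have "l < l / (1 - b)" using b l1 by (simp add: field_simps)
  ultimately have "\<Lambda> \<le> l" by (simp add: l'_def min_le_iff_disj)
  then show ?thesis using near l1 by simp
qed

text \<open>That \<open>\<mu>\<close> stays nearest for the stretched point bounds the inner product
  of \<open>\<nu> - \<mu>\<close> and \<open>x - \<mu>\<close> by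
  \<open>|\<nu> - \<mu>|^2 / (2 * \<Lambda>)\<close>. As \<open>\<Lambda> > 1\<close>, this term is
  absorbed when \<open>\<mu>\<close> and \<open>\<nu>\<close> are compared from
  \<open>y\<close>.\<close>

lemma nearest_point_perturbation:
  assumes M: "smooth_compact_submanifold m M" and D: "infdist x M \<le> D" "D > 0" and e: "e > 0"
    and avoid: "\<And>z. dist z x < e \<Longrightarrow> z \<notin> cutlocus m M" and y: "dist y x < e"
  shows "norm (nearest_point M y - nearest_point M x) \<le> 2 * norm (y - x) * (1 + 2 * D / e)"
proof -
  define \<mu> \<nu> where "\<mu> = nearest_point M x" and "\<nu> = nearest_point M y"
  have \<mu>: "is_nearest M x \<mu>" and \<nu>: "is_nearest M y \<nu>"
    unfolding \<mu>_def \<nu>_def using avoid y e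
    by (auto intro!: is_nearest_nearest_point[of _ m])
  have "\<mu> \<in> M" "\<nu> \<in> M" using \<mu> \<nu> by (auto simp: is_nearest_def)
  have "norm (\<mu> - x) \<le> dist x a" if "a \<in> M" for a
    using \<mu> that by (simp add: is_nearest_def dist_norm norm_minus_commute)
  then have "norm (\<mu> - x) \<le> infdist x M"
    using \<open>\<mu> \<in> M\<close> unfolding infdist_def by (auto intro!: cINF_greatest)
  then have r: "norm (x - \<mu>) \<le> D" using D by (simp add: norm_minus_commute)
  \<comment> \<open>The stretched points lie within \<open>(\<Lambda> - 1) * D = e / 2\<close> of
    \<open>x\<close>, hence off the cutlocus.\<close>
  define \<Lambda> where "\<Lambda> = 1 + e / (2 * D)"
  have \<Lambda>: "\<Lambda> > 1" using D e by (simp add: \<Lambda>_def)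
  have "\<mu> + l *\<^sub>R (x - \<mu>) \<notin> cutlocus m M" if l: "1 \<le> l" "l \<le> \<Lambda>" for l
  proof (rule avoid)
    have "(\<mu> + l *\<^sub>R (x - \<mu>)) - x = (l - 1) *\<^sub>R (x - \<mu>)" by (simp add: algebra_simps)
    then have "dist (\<mu> + l *\<^sub>R (x - \<mu>)) x = (l - 1) * norm (x - \<mu>)" using l by (simp add: dist_norm)
    also have "\<dots> \<le> (e / (2 * D)) * D" using l r D e by (intro mult_mono) (auto simp: \<Lambda>_def)
    also have "\<dots> < e" using D e by simp
    finally show "dist (\<mu> + l *\<^sub>R (x - \<mu>)) x < e" .
  qed
  then have "is_nearest M (\<mu> + \<Lambda> *\<^sub>R (x - \<mu>)) \<mu>"
    using nearest_extends_along_ray[OF M \<mu>] \<Lambda> by simp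
  then have ray: "2 * \<Lambda> * ((\<nu> - \<mu>) \<bullet> (x - \<mu>)) \<le> (norm (\<nu> - \<mu>))\<^sup>2"
    using \<open>\<nu> \<in> M\<close> unfolding is_nearest_on_ray by blast
  let ?a = "norm (\<nu> - \<mu>)"
  have "(norm (\<nu> - y))\<^sup>2 \<le> (norm (\<mu> - y))\<^sup>2"
    using \<nu> \<open>\<mu> \<in> M\<close> by (auto simp: is_nearest_def intro: power_mono)
  moreover have "(norm (\<nu> - y))\<^sup>2 = ?a\<^sup>2 - 2 * ((\<nu> - \<mu>) \<bullet> (y - x)) - 2 * ((\<nu> - \<mu>) \<bullet> (x - \<mu>)) + (norm (\<mu> - y))\<^sup>2"
    unfolding power2_norm_eq_inner by (simp add: inner_diff_left inner_diff_right inner_commute algebra_simps)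
  moreover have "(\<nu> - \<mu>) \<bullet> (y - x) \<le> ?a * norm (y - x)" by (rule norm_cauchy_schwarz)
  ultimately have "?a\<^sup>2 \<le> 2 * (?a * norm (y - x)) + 2 * ((\<nu> - \<mu>) \<bullet> (x - \<mu>))" by linarith
  \<comment> \<open>After scaling by \<open>\<Lambda>\<close> the ray inequality replaces the inner
    product by one \<open>?a\<^sup>2\<close>, which leaves the factor
    \<open>\<Lambda> / (\<Lambda> - 1) = 1 + 2 * D / e\<close>.\<close>
  then have "\<Lambda> * ?a\<^sup>2 \<le> \<Lambda> * (2 * (?a * norm (y - x)) + 2 * ((\<nu> - \<mu>) \<bullet> (x - \<mu>)))"
    using \<Lambda> by (intro mult_left_mono) auto
  also have "\<dots> \<le> 2 * \<Lambda> * (?a * norm (y - x)) + ?a\<^sup>2" using ray by (simp add: algebra_simps)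
  finally have "((\<Lambda> - 1) * ?a) * ?a \<le> (2 * \<Lambda> * norm (y - x)) * ?a"
    by (simp add: power2_eq_square algebra_simps)
  then have "(\<Lambda> - 1) * ?a \<le> 2 * \<Lambda> * norm (y - x)"
    using \<Lambda> by (cases "?a = 0") (auto dest: mult_right_le_imp_le)
  then have "?a \<le> 2 * \<Lambda> * norm (y - x) / (\<Lambda> - 1)" using \<Lambda> by (simp add: field_simps)
  also have "\<dots> = 2 * norm (y - x) * (1 + 2 * D / e)"
    using D e by (simp add: \<Lambda>_def field_simps)
  finally show ?thesis by (simp add: \<mu>_def \<nu>_def)
qed

section \<open>Tightness from convergence in distribution\<close>

text \<open>The event lies eventually outside any fixed ball for \<open>X n\<close>. A continuous
  cutoff dominates its indicator, and the integral of the cutoff against the limit law is small for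
  a large ball.\<close>

lemma conv_in_distribution_tight:
  fixes X :: "nat \<Rightarrow> 'a \<Rightarrow> 'c::euclidean_space" and Y :: "'b \<Rightarrow> 'c"
  assumes P: "prob_space P" and Q: "prob_space Q"
    and X: "\<And>n. X n \<in> borel_measurable P" and Y: "Y \<in> borel_measurable Q"
    and conv: "conv_in_distribution P X Q Y"
    and r: "r \<longlonglongrightarrow> 0" "\<And>n. 0 \<le> r n"
  shows "(\<lambda>n. measure P {\<omega> \<in> space P. 1 \<le> r n * norm (X n \<omega>)}) \<longlonglongrightarrow> 0"
proof -
  interpret P: prob_space P by (rule P)
  interpret Q: prob_space Q by (rule Q)
  \<comment> \<open>A ramp, 0 up to radius \<open>k\<close> and 1 from radius \<open>k + 1\<close>
    on: convergence in distribution is stated for continuous test functions, so indicators must be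
    replaced.\<close>
  define f where "f k z = max 0 (min 1 (norm z - real k))" for k and z :: 'c
  have f01: "0 \<le> f k z" "f k z \<le> 1" for k z by (auto simp: f_def)
  have fcont: "continuous_on UNIV (f k)" for k
    unfolding f_def by (intro continuous_intros)
  then have fmeas: "f k \<in> borel_measurable borel" for k
    by (rule borel_measurable_continuous_onI)
  have fbdd: "bounded (range (f k))" for k
    unfolding bounded_iff by (rule exI[of _ 1]) (use f01 in auto)
  have "(\<lambda>k. \<integral>\<omega>. f k (Y \<omega>) \<partial>Q) \<longlonglongrightarrow> (\<integral>\<omega>. 0 \<partial>Q)"
  proof (rule integral_dominated_convergence[where w = "\<lambda>_. 1"])
    show "AE \<omega> in Q. (\<lambda>k. f k (Y \<omega>)) \<longlonglongrightarrow> 0"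
    proof (rule AE_I2)
      fix \<omega>
      obtain N where "norm (Y \<omega>) \<le> real N" using real_arch_simple by blast
      then have "f k (Y \<omega>) = 0" if "k \<ge> N" for k using that by (simp add: f_def)
      then show "(\<lambda>k. f k (Y \<omega>)) \<longlonglongrightarrow> 0"
        by (intro tendsto_eventually) (auto simp: eventually_sequentially)
    qed
  qed (use f01 measurable_compose[OF Y fmeas] in auto)
  then have lim: "(\<lambda>k. \<integral>\<omega>. f k (Y \<omega>) \<partial>Q) \<longlonglongrightarrow> 0" by simp
  show ?thesis
  proof (rule order_tendstoI)
    fix a :: real assume "a < 0"
    then show "\<forall>\<^sub>F n in sequentially. a < measure P {\<omega> \<in> space P. 1 \<le> r n * norm (X n \<omega>)}"
      by (intro always_eventually allI) (meson measure_nonneg less_le_trans)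
  next
    fix a :: real assume "0 < a"
    then obtain k where k: "(\<integral>\<omega>. f k (Y \<omega>) \<partial>Q) < a"
      using eventually_happens[OF order_tendstoD(2)[OF lim]] by auto
    have "(\<lambda>n. \<integral>\<omega>. f k (X n \<omega>) \<partial>P) \<longlonglongrightarrow> (\<integral>\<omega>. f k (Y \<omega>) \<partial>Q)"
      using conv fcont fbdd unfolding conv_in_distribution_def by blast
    then have 1: "\<forall>\<^sub>F n in sequentially. (\<integral>\<omega>. f k (X n \<omega>) \<partial>P) < a"
      using k by (rule order_tendstoD)
    \<comment> \<open>Once \<open>r n * (real k + 1) < 1\<close>, the event forces
      \<open>norm (X n \<omega>) > real k + 1\<close>, where the ramp equals 1.\<close>
    have "(\<lambda>n. r n * (real k + 1)) \<longlonglongrightarrow> 0" using tendsto_mult_right[OF r(1)] by simp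
    then have 2: "\<forall>\<^sub>F n in sequentially. r n * (real k + 1) < 1" by (rule order_tendstoD) simp
    show "\<forall>\<^sub>F n in sequentially. measure P {\<omega> \<in> space P. 1 \<le> r n * norm (X n \<omega>)} < a"
      using 1 2
    proof eventually_elim
      case (elim n)
      let ?A = "{\<omega> \<in> space P. 1 \<le> r n * norm (X n \<omega>)}"
      have A: "?A \<in> sets P" using X by measurable
      have int: "integrable P (\<lambda>\<omega>. f k (X n \<omega>))"
        by (rule P.integrable_const_bound[where B = 1])
          (use f01 measurable_compose[OF X fmeas] in auto)
      have "indicator ?A \<omega> \<le> f k (X n \<omega>)" for \<omega>
      proof (cases "\<omega> \<in> ?A")
        case True
        then have "r n * (real k + 1) < r n * norm (X n \<omega>)" using elim(2) by simp
        then have "real k + 1 < norm (X n \<omega>)" using r(2)[of n] by (rule mult_left_less_imp_less)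
        then show ?thesis by (simp add: f_def indicator_def)
      qed (simp add: f01)
      then have "(\<integral>\<omega>. indicator ?A \<omega> \<partial>P) \<le> (\<integral>\<omega>. f k (X n \<omega>) \<partial>P)"
        using A int by (intro integral_mono) (auto simp: P.emeasure_eq_measure)
      then have "measure P ?A \<le> (\<integral>\<omega>. f k (X n \<omega>) \<partial>P)" using A by simp
      with elim(1) show ?case by simp
    qed
  qed
qed

section \<open>Matrices and the final probability estimate\<close>

lemma matrix_inv_right_inverse:
  fixes A :: "real^'n^'m"
  assumes "invertible A"
  shows "A ** matrix_inv A = mat 1"
  using someI_ex[OF assms[unfolded invertible_def]] unfolding matrix_inv_def by blast

lemma onorm_matrix_tendsto_0:
  fixes B :: "nat \<Rightarrow> real^'n^'m"
  assumes "B \<longlonglongrightarrow> 0"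
  shows "(\<lambda>n. onorm ((*v) (B n))) \<longlonglongrightarrow> 0"
proof (rule tendsto_sandwich[OF _ _ tendsto_const])
  show "\<forall>\<^sub>F n in sequentially. 0 \<le> onorm ((*v) (B n))"
    by (intro always_eventually allI onorm_pos_le matrix_vector_mul_bounded_linear)
  show "\<forall>\<^sub>F n in sequentially. onorm ((*v) (B n)) \<le> (\<Sum>i\<in>UNIV. \<Sum>j\<in>UNIV. \<bar>B n $ i $ j\<bar>)"
    by (intro always_eventually allI onorm_le_matrix_component_sum)
  have "(\<lambda>n. \<Sum>i\<in>UNIV. \<Sum>j\<in>UNIV. \<bar>B n $ i $ j\<bar>) \<longlonglongrightarrow> (\<Sum>i\<in>UNIV. \<Sum>j\<in>UNIV. \<bar>(0::real^'n^'m) $ i $ j\<bar>)"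
    by (intro tendsto_sum tendsto_rabs tendsto_vec_nth assms)
  then show "(\<lambda>n. \<Sum>i\<in>UNIV. \<Sum>j\<in>UNIV. \<bar>B n $ i $ j\<bar>) \<longlonglongrightarrow> 0" by simp
qed

theorem theorem2p1:
  fixes m :: nat and M :: "(real^'s) set"
    and P :: "'a measure" and Pz :: "'b measure"
    and t :: "nat \<Rightarrow> real^'s" and tt :: "nat \<Rightarrow> 'a \<Rightarrow> real^'s"
    and B :: "nat \<Rightarrow> real^'s^'s" and Z :: "'b \<Rightarrow> real^'s" and D :: real
  assumes M: "smooth_compact_submanifold m M"
    and P: "prob_space P" and Pz: "prob_space Pz"
    and tt_rv: "\<And>n. tt n \<in> borel_measurable P"
    and Z_rv: "Z \<in> borel_measurable Pz"
    and B_inv: "\<And>n. invertible (B n)"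
    and B_lim: "B \<longlonglongrightarrow> 0"
    and conv: "conv_in_distribution P (\<lambda>n \<omega>. matrix_inv (B n) *v (tt n \<omega> - t n)) Pz Z"
    and t_notin: "\<And>n. t n \<notin> cutlocus m M"
    and D_pos: "D > 0"
    and t_near: "\<And>n. infdist (t n) M \<le> D"
    and ratio: "(\<lambda>n. onorm (\<lambda>x. B n *v x) / infdist (t n) (cutlocus m M)) \<longlonglongrightarrow> 0"
  shows "\<forall>\<epsilon>>0. \<exists>A. (\<forall>n. A n \<in> sets P \<and>
            {\<omega> \<in> space P. tt n \<omega> \<in> cutlocus m M \<or>
               \<epsilon> < norm (nearest_point M (tt n \<omega>) - nearest_point M (t n))} \<subseteq> A n) \<and>
          (\<lambda>n. measure P (A n)) \<longlonglongrightarrow> 0"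
proof (intro allI impI)
  fix \<epsilon> :: real assume \<epsilon>: "\<epsilon> > 0"
  interpret P: prob_space P by (rule P)
  let ?C = "cutlocus m M"
  \<comment> \<open>For an empty cutlocus \<^const>\<open>infdist\<close> is 0 and any positive number serves as the distance.\<close>
  define e where "e n = (if ?C = {} then 1 else infdist (t n) ?C)" for n
  define q where "q n = onorm ((*v) (B n))" for n
  have e_pos: "e n > 0" for n
    using infdist_pos_not_in_closed[OF closed_cutlocus[OF M] _ t_notin] by (simp add: e_def)
  have avoid: "z \<notin> ?C" if "dist z (t n) < e n" for z n
    using that infdist_le[of z ?C "t n"] by (auto simp: e_def dist_commute split: if_splits)
  have q: "q \<longlonglongrightarrow> 0" "\<And>n. 0 \<le> q n"
    using onorm_matrix_tendsto_0[OF B_lim]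
    by (auto simp: q_def[abs_def] intro: onorm_pos_le matrix_vector_mul_bounded_linear)
  \<comment> \<open>For an empty cutlocus \<open>e n = 1\<close> and this follows from
    \<open>B_lim\<close>; otherwise it is \<open>ratio\<close>.\<close>
  have qe: "(\<lambda>n. q n / e n) \<longlonglongrightarrow> 0"
    using ratio q(1) by (cases "?C = {}") (simp_all add: e_def q_def[abs_def])
  define X where "X n \<omega> = matrix_inv (B n) *v (tt n \<omega> - t n)" for n \<omega>
  have X_meas: "X n \<in> borel_measurable P" for n
  proof -
    have "(\<lambda>v. matrix_inv (B n) *v (v - t n)) \<in> borel_measurable borel"
      by (intro borel_measurable_continuous_onI continuous_intros matrix_vector_mult_linear_continuous_on
          continuous_on_compose2[OF matrix_vector_mult_linear_continuous_on, where s = UNIV]) auto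
    then show ?thesis unfolding X_def by (rule measurable_compose[OF tt_rv])
  qed
  have X_bound: "norm (tt n \<omega> - t n) \<le> q n * norm (X n \<omega>)" for n \<omega>
  proof -
    have "B n *v X n \<omega> = tt n \<omega> - t n"
      by (simp add: X_def matrix_vector_mul_assoc matrix_inv_right_inverse[OF B_inv])
    then show ?thesis
      using onorm[OF matrix_vector_mul_bounded_linear, of "B n" "X n \<omega>"] by (simp add: q_def)
  qed
  \<comment> \<open>If \<open>r n * norm (X n \<omega>) < 1\<close>, both summands contribute less
    than 1: the first keeps \<open>tt n \<omega>\<close> within \<open>e n\<close> of
    \<open>t n\<close>, the second makes the perturbation bound smaller than
    \<open>\<epsilon>\<close>.\<close>
  define r where "r n = q n / e n + 2 / \<epsilon> * (q n + 2 * D * (q n / e n))" for n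
  have "r \<longlonglongrightarrow> 0 + 2 / \<epsilon> * (0 + 2 * D * 0)"
    unfolding r_def by (intro tendsto_intros q qe)
  then have r: "r \<longlonglongrightarrow> 0" by simp
  have r0: "0 \<le> r n" for n
    using q(2)[of n] e_pos[of n] \<epsilon> D_pos by (simp add: r_def)
  have "conv_in_distribution P X Pz Z" using conv by (simp add: X_def[abs_def])
  from conv_in_distribution_tight[OF P Pz X_meas Z_rv this r r0]
  have small: "(\<lambda>n. measure P {\<omega> \<in> space P. 1 \<le> r n * norm (X n \<omega>)}) \<longlonglongrightarrow> 0" .
  show "\<exists>A. (\<forall>n. A n \<in> sets P \<and>
            {\<omega> \<in> space P. tt n \<omega> \<in> ?C \<or>
               \<epsilon> < norm (nearest_point M (tt n \<omega>) - nearest_point M (t n))} \<subseteq> A n) \<and>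
          (\<lambda>n. measure P (A n)) \<longlonglongrightarrow> 0"
  \<comment> \<open>The witness is a measurable event covering the exceptional set, whose own
    measurability is not established.\<close>
  proof (intro exI[of _ "\<lambda>n. {\<omega> \<in> space P. 1 \<le> r n * norm (X n \<omega>)}"] conjI allI small subsetI)
    show "{\<omega> \<in> space P. 1 \<le> r n * norm (X n \<omega>)} \<in> sets P" for n
      using X_meas by measurable
    fix n \<omega>
    assume \<omega>: "\<omega> \<in> {\<omega> \<in> space P. tt n \<omega> \<in> ?C \<or>
      \<epsilon> < norm (nearest_point M (tt n \<omega>) - nearest_point M (t n))}"
    have "1 \<le> r n * norm (X n \<omega>)"
    proof (rule ccontr)
      assume less: "\<not> 1 \<le> r n * norm (X n \<omega>)"
      let ?x = "norm (X n \<omega>)"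
      let ?s = "q n / e n * ?x" and ?u = "2 / \<epsilon> * (q n + 2 * D * (q n / e n)) * ?x"
      have "?s + ?u < 1" using less by (simp add: r_def algebra_simps)
      moreover have "0 \<le> ?s" "0 \<le> ?u" using q(2)[of n] e_pos[of n] \<epsilon> D_pos by auto
      ultimately have "?s < 1" "?u < 1" by linarith+
      have "q n * ?x < e n" using \<open>?s < 1\<close> e_pos[of n] by (simp add: field_simps)
      then have near: "dist (tt n \<omega>) (t n) < e n"
        using X_bound[of n \<omega>] by (simp add: dist_norm)
      have "norm (nearest_point M (tt n \<omega>) - nearest_point M (t n))
          \<le> 2 * norm (tt n \<omega> - t n) * (1 + 2 * D / e n)"
        by (rule nearest_point_perturbation[OF M t_near D_pos e_pos avoid near])
      also have "\<dots> \<le> 2 * (q n * ?x) * (1 + 2 * D / e n)"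
        using X_bound[of n \<omega>] e_pos[of n] D_pos by (intro mult_right_mono) auto
      also have "\<dots> = \<epsilon> * ?u" using \<epsilon> e_pos[of n] by (simp add: field_simps)
      also have "\<dots> < \<epsilon>" using \<open>?u < 1\<close> \<epsilon> by simp
      finally show False using \<omega> avoid[OF near] by simp
    qed
    then show "\<omega> \<in> {\<omega> \<in> space P. 1 \<le> r n * norm (X n \<omega>)}" using \<omega> by simp
  qed
qed

end
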